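(* Let $I=[0,2\pi]$, let $h\geq 1$ be an integer and let $\theta,\phi\in C^h(I,\mathbb{R})$. Assume that for every $a\in\mathbb{R}$ which is a regular value of $\phi$ and satisfies $a\neq\phi(0)$ and $a\neq\phi(2\pi)$ one has $$\sum_{b\in\phi^{-1}(a)}\frac{\mathrm{e}^{i\theta(b)}}{|\phi'(b)|}=0.$$ Assume moreover that $\phi(0)$ is not a critical value of $\phi$. Then $\phi(0)=\phi(2\pi)$, and one of the following two alternatives holds: either (i) $\theta(2\pi)-\theta(0)\equiv 0 \mod 2\pi$, $\theta^{(k)}(0)=\theta^{(k)}(2\pi)$ for all $1\leq k\leq h-1$, and $\phi^{(k)}(0)=\phi^{(k)}(2\pi)$ for all $1\leq k\leq h$; or (ii) $\theta(2\pi)-\theta(0)\equiv \pi \mod 2\pi$, $\theta^{(k)}(0)=(-1)^k\theta^{(k)}(2\pi)$ for all $1\leq k\leq h-1$, and $\phi^{(k)}(0)=(-1)^k\phi^{(k)}(2\pi)$ for all $1\leq k\leq h$.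
   Context: A real number $a$ is a critical value of $\phi$ if there is $t\in I$ with $\phi(t)=a$ and $\phi'(t)=0$; it is a regular value otherwise, i.e. if $\phi'(t)\neq0$ for all $t\in\phi^{-1}(a)$ (in which case $\phi^{-1}(a)$ is finite). Derivatives at the endpoints $0,2\pi$ of $I$ are one-sided. An empty sum is $0$. The superscript $(k)$ denotes the $k$-th derivative. *)

theory Defs
  imports "HOL-Analysis.Analysis" "HOL-Library.Real_Mod"
begin

text \<open>Differentiation is relative to \<open>I\<close>, hence one-sided at the endpoints; values of \<open>f\<close> outside
  \<open>I\<close> play no role at points of \<open>I\<close>.\<close>

definition I :: "real set" where
  "I = {0..2 * pi}"

primrec nderiv :: "nat \<Rightarrow> (real \<Rightarrow> real) \<Rightarrow> real \<Rightarrow> real" where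
  "nderiv 0 f = f"
| "nderiv (Suc k) f = (\<lambda>t. vector_derivative (nderiv k f) (at t within I))"

definition C_on_I :: "nat \<Rightarrow> (real \<Rightarrow> real) \<Rightarrow> bool" where
  "C_on_I h f \<longleftrightarrow> (\<forall>k<h. nderiv k f differentiable_on I) \<and> continuous_on I (nderiv h f)"

definition critical_value :: "(real \<Rightarrow> real) \<Rightarrow> real \<Rightarrow> bool" where
  "critical_value \<phi> a \<longleftrightarrow> (\<exists>t\<in>I. \<phi> t = a \<and> nderiv 1 \<phi> t = 0)"

text \<open>Values not attained by \<open>\<phi>\<close> are regular.\<close>

definition regular_value :: "(real \<Rightarrow> real) \<Rightarrow> real \<Rightarrow> bool" where
  "regular_value \<phi> a \<longleftrightarrow> \<not> critical_value \<phi> a"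

end

theory Submission
  imports Defs "HOL-Library.Landau_Symbols"
begin

text \<open>
  The hypothesis is an identity between finitely many smooth branches, and the conclusion is read
  off at the level \<open>\<phi> 0\<close>, where the branches issuing from the two ends of the interval stop.

  Replace \<open>\<phi>\<close> by \<open>\<psi> = s (\<phi> - \<phi> 0)\<close>, where \<open>s\<close> is the sign of \<open>\<phi>' 0\<close>, so that \<open>\<psi> 0 = 0\<close> and
  \<open>\<psi>' 0 > 0\<close>, and extend \<open>\<psi>\<close> and \<open>\<theta>\<close> to \<open>C\<^sup>h\<close> functions on the line (\<open>C_on_I_extend\<close>). Near the
  regular level \<open>0\<close> the preimages of \<open>y\<close> are values \<open>g\<^sub>b y\<close> of finitely many local inverses, one for each
  zero \<open>b\<close> of \<open>\<psi>\<close> (\<open>level_sets_near_zero\<close>), and the hypothesis becomes a vanishing sum of functions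
  \<open>F\<^sub>b y = exp (i \<theta> (g\<^sub>b y)) / \<bar>\<psi>' (g\<^sub>b y)\<bar>\<close> of class \<open>C\<^bsup>h - 1\<^esup>\<close>. An interior zero contributes on both
  sides of \<open>y = 0\<close>; the zero \<open>0\<close> contributes only for \<open>y > 0\<close>; the other endpoint contributes on at
  most one side. Let \<open>T\<close> be the sum of the branches that are present for \<open>y < 0\<close>. It is of class
  \<open>C\<^bsup>h - 1\<^esup>\<close> on a full neighbourhood of \<open>0\<close> and vanishes on the left, hence it is \<open>o(y\<^bsup>h - 1\<^esup>)\<close> on the
  right as well. Subtracting the identity that holds on the right leaves only the two endpoint
  branches (\<open>endpoint_branches_cancel\<close>): if \<open>\<psi>\<close> did not vanish at \<open>2\<pi>\<close>, then \<open>F\<^sub>0\<close> would tend to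
  \<open>0\<close>, which is absurd; otherwise \<open>F\<^sub>0 - \<epsilon> F\<^bsub>2\<pi>\<^esub> = o(y\<^bsup>h - 1\<^esup>)\<close>, where \<open>\<epsilon>\<close> is the sign of \<open>\<psi>' (2\<pi>)\<close>.
  The two signs of \<open>\<epsilon>\<close> are the two alternatives of the theorem.

  It remains to recover both functions from a branch (\<open>branches_agree\<close>). Put
  \<open>\<xi> t = \<psi> (2\<pi> + \<epsilon> t)\<close> and \<open>\<eta> t = \<theta> (2\<pi> + \<epsilon> t)\<close>, which turns the second branch into a branch at
  \<open>0\<close>. The moduli of the branches are the derivatives of the local inverses \<open>G\<close> and \<open>H\<close> of \<open>\<psi>\<close> and
  \<open>\<xi>\<close>, so the reverse triangle inequality gives \<open>G' - H' = o(y\<^bsup>h - 1\<^esup>)\<close>; integration gives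
  \<open>G - H = o(y\<^sup>h)\<close>, and applying \<open>\<xi>\<close> gives \<open>\<psi> - \<xi> = o(t\<^sup>h)\<close>. Dividing out the moduli, the phases
  satisfy \<open>exp (i (\<theta> - \<eta>)) - \<epsilon> = o(t\<^bsup>h - 1\<^esup>)\<close>, so \<open>\<theta> - \<eta>\<close> is constant up to \<open>o(t\<^bsup>h - 1\<^esup>)\<close> and the
  constant is \<open>0\<close> or \<open>\<pi>\<close> modulo \<open>2\<pi>\<close>. A function of class \<open>C\<^sup>k\<close> that is \<open>o(t\<^sup>k)\<close> has vanishing
  derivatives up to order \<open>k\<close> at \<open>0\<close> (\<open>flat_imp_derivs_eq_0\<close>), and the derivatives of \<open>\<xi>\<close> and \<open>\<eta>\<close>
  at \<open>0\<close> are those of \<open>\<psi>\<close> and \<open>\<theta>\<close> at \<open>2\<pi>\<close> multiplied by powers of \<open>\<epsilon>\<close>.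
\<close>

section \<open>Functions of class \<open>C\<^sup>n\<close> on a set of reals\<close>

text \<open>The derivative is an existential witness and not an iterated derivative operator, so that
  vector-valued functions are covered and the closure properties below follow by induction
  on \<open>n\<close> from the first-order differentiation rules. Derivatives are two-sided at every point of \<open>U\<close>, which
  is meant to be open.\<close>
primrec Ck :: "nat \<Rightarrow> real set \<Rightarrow> (real \<Rightarrow> 'a::real_normed_vector) \<Rightarrow> bool" where
  "Ck 0 U f = continuous_on U f"
| "Ck (Suc n) U f = (\<exists>f'. (\<forall>x\<in>U. (f has_vector_derivative f' x) (at x)) \<and> Ck n U f')"

lemma Ck_subset: "Ck n U f \<Longrightarrow> V \<subseteq> U \<Longrightarrow> Ck n V f"
  by (induction n arbitrary: f) (auto intro: continuous_on_subset)

lemma Ck_Suc_imp_Ck: "Ck (Suc n) U f \<Longrightarrow> Ck n U f"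
proof (induction n arbitrary: f)
  case 0
  then show ?case
    by (auto intro!: continuous_at_imp_continuous_on) (blast intro: has_vector_derivative_continuous)
next
  case (Suc n)
  then show ?case by (metis Ck.simps(2))
qed

lemma Ck_le: "Ck n U f \<Longrightarrow> m \<le> n \<Longrightarrow> Ck m U f"
  by (induction n) (auto simp del: Ck.simps simp: le_Suc_eq dest: Ck_Suc_imp_Ck)

lemma Ck_continuous_on: "Ck n U f \<Longrightarrow> continuous_on U f"
  using Ck_le[of n U f 0] by simp

lemma Ck_const: "Ck n U (\<lambda>x. c)"
  by (induction n arbitrary: c) (auto intro!: exI[of _ "\<lambda>x. 0"])

lemma Ck_affine: "Ck n U (\<lambda>x::real. p + c * x)"
proof (cases n)
  case (Suc m)
  then show ?thesis
    by (auto intro!: exI[of _ "\<lambda>x. c"] Ck_const derivative_eq_intros)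
qed (auto intro!: continuous_intros)

lemma Ck_add: "Ck n U f \<Longrightarrow> Ck n U g \<Longrightarrow> Ck n U (\<lambda>x. f x + g x)"
proof (induction n arbitrary: f g)
  case (Suc n)
  then obtain f' g' where "\<forall>x\<in>U. (f has_vector_derivative f' x) (at x)" "Ck n U f'"
    "\<forall>x\<in>U. (g has_vector_derivative g' x) (at x)" "Ck n U g'" by auto
  then show ?case
    by (auto intro!: exI[of _ "\<lambda>x. f' x + g' x"] Suc.IH has_vector_derivative_add)
qed (auto intro: continuous_intros)

lemma Ck_sum: "(\<And>i. i \<in> A \<Longrightarrow> Ck n U (f i)) \<Longrightarrow> Ck n U (\<lambda>x. \<Sum>i\<in>A. f i x)"
  by (induction A rule: infinite_finite_induct) (auto intro: Ck_const Ck_add)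

lemma Ck_bilinear:
  assumes "bounded_bilinear mul"
  shows "Ck n U f \<Longrightarrow> Ck n U g \<Longrightarrow> Ck n U (\<lambda>x. mul (f x) (g x))"
proof (induction n arbitrary: f g)
  case 0
  then show ?case using bounded_bilinear.continuous_on[OF assms] by auto
next
  case (Suc n)
  then obtain f' g' where d: "\<forall>x\<in>U. (f has_vector_derivative f' x) (at x)" "Ck n U f'"
    "\<forall>x\<in>U. (g has_vector_derivative g' x) (at x)" "Ck n U g'" by auto
  have "Ck n U (\<lambda>x. mul (f x) (g' x) + mul (f' x) (g x))"
    using d Suc.prems[THEN Ck_Suc_imp_Ck] by (intro Ck_add Suc.IH)
  moreover have "\<forall>x\<in>U. ((\<lambda>x. mul (f x) (g x)) has_vector_derivative
      mul (f x) (g' x) + mul (f' x) (g x)) (at x)"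
    using d bounded_bilinear.has_vector_derivative[OF assms] by blast
  ultimately show ?case by auto
qed

lemmas Ck_scaleR = Ck_bilinear[OF bounded_bilinear_scaleR]
lemmas Ck_mult = Ck_bilinear[OF bounded_bilinear_mult]

lemma Ck_compose:
  fixes g :: "real \<Rightarrow> real"
  shows "Ck n U g \<Longrightarrow> g ` U \<subseteq> V \<Longrightarrow> Ck n V f \<Longrightarrow> Ck n U (\<lambda>x. f (g x))"
proof (induction n arbitrary: f)
  case 0
  then show ?case by (auto intro: continuous_on_compose2)
next
  case (Suc n)
  then obtain f' g' where d: "\<forall>x\<in>V. (f has_vector_derivative f' x) (at x)" "Ck n V f'"
    "\<forall>x\<in>U. (g has_vector_derivative g' x) (at x)" "Ck n U g'" by auto
  have "Ck n U (\<lambda>x. g' x *\<^sub>R f' (g x))"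
    using d Suc.prems(2) Suc.prems(1,3)[THEN Ck_Suc_imp_Ck] by (intro Ck_scaleR Suc.IH)
  moreover have "\<forall>x\<in>U. ((\<lambda>x. f (g x)) has_vector_derivative g' x *\<^sub>R f' (g x)) (at x)"
    using d Suc.prems vector_diff_chain_at[of g _ _ f] by (auto simp: o_def)
  ultimately show ?case by auto
qed

lemma Ck_inverse:
  fixes f :: "real \<Rightarrow> real"
  shows "Ck n U f \<Longrightarrow> (\<And>x. x \<in> U \<Longrightarrow> f x \<noteq> 0) \<Longrightarrow> Ck n U (\<lambda>x. inverse (f x))"
proof (induction n)
  case 0
  then show ?case by (auto intro: continuous_intros)
next
  case (Suc n)
  then obtain f' where d: "\<forall>x\<in>U. (f has_vector_derivative f' x) (at x)" "Ck n U f'" by auto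
  have i: "Ck n U (\<lambda>x. inverse (f x))" using Suc Ck_Suc_imp_Ck by blast
  have "Ck n U (\<lambda>x. (- 1 * f' x) * (inverse (f x) * inverse (f x)))"
    using d i by (intro Ck_mult Ck_const)
  moreover have "\<forall>x\<in>U. ((\<lambda>x. inverse (f x)) has_vector_derivative
      (- 1 * f' x) * (inverse (f x) * inverse (f x))) (at x)"
    using d Suc.prems
    by (auto simp: has_real_derivative_iff_has_vector_derivative[symmetric]
        intro!: derivative_eq_intros)
  ultimately show ?case unfolding Ck.simps by (intro exI conjI)
qed

lemma has_vector_derivative_cis:
  "(cis has_vector_derivative \<i> * cis x) (at x)"
proof -
  have "((\<lambda>t. exp (t *\<^sub>R \<i>)) has_vector_derivative exp (x *\<^sub>R \<i>) * \<i>) (at x)"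
    by (rule exp_scaleR_has_vector_derivative_right)
  then show ?thesis by (simp add: cis_conv_exp[abs_def] scaleR_conv_of_real mult.commute)
qed

lemma Ck_cis: "Ck n U cis"
proof -
  have "Ck n U (\<lambda>t. c * cis t)" for c
  proof (induction n arbitrary: c)
    case 0
    then show ?case by (auto intro!: continuous_intros)
  next
    case (Suc n)
    have "\<forall>x\<in>U. ((\<lambda>t. c * cis t) has_vector_derivative (c * \<i>) * cis x) (at x)"
      by (auto intro!: derivative_eq_intros has_vector_derivative_mult_right
          has_vector_derivative_cis simp: mult.assoc)
    then show ?case unfolding Ck.simps using Suc[of "c * \<i>"] by (intro exI conjI)
  qed
  from this[of 1] show ?thesis by simp
qed

section \<open>Higher derivatives and extension beyond the interval\<close>
lemma Ck_SucD:
  fixes f :: "real \<Rightarrow> real"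
  assumes "Ck (Suc n) UNIV f"
  shows "(f has_real_derivative deriv f x) (at x)" "Ck n UNIV (deriv f)"
proof -
  obtain f' where d: "\<forall>x. (f has_real_derivative f' x) (at x)" "Ck n UNIV f'"
    using assms by (auto simp: has_real_derivative_iff_has_vector_derivative)
  then have "deriv f = f'" by (auto intro: DERIV_imp_deriv)
  then show "(f has_real_derivative deriv f x) (at x)" "Ck n UNIV (deriv f)" using d by auto
qed

lemma Ck_funpow_deriv:
  fixes f :: "real \<Rightarrow> real"
  shows "Ck n UNIV f \<Longrightarrow> k \<le> n \<Longrightarrow> Ck (n - k) UNIV ((deriv ^^ k) f)"
proof (induction k)
  case (Suc k)
  then have "Ck (Suc (n - Suc k)) UNIV ((deriv ^^ k) f)" by (simp add: Suc_diff_Suc del: Ck.simps)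
  then show ?case using Ck_SucD(2) by simp
qed auto

lemma funpow_deriv_has_derivative:
  fixes f :: "real \<Rightarrow> real"
  assumes "Ck n UNIV f" "k < n"
  shows "((deriv ^^ k) f has_real_derivative (deriv ^^ Suc k) f x) (at x)"
proof -
  have "Ck (Suc (n - Suc k)) UNIV ((deriv ^^ k) f)"
    using Ck_funpow_deriv[OF assms(1), of k] assms(2) by (simp add: Suc_diff_Suc del: Ck.simps)
  then show ?thesis using Ck_SucD(1) by simp
qed

lemma funpow_deriv_lincomb:
  fixes f g :: "real \<Rightarrow> real"
  assumes "Ck n UNIV f" "Ck n UNIV g" "k \<le> n"
  shows "(deriv ^^ k) (\<lambda>t. a * f t + b * g t) = (\<lambda>t. a * (deriv ^^ k) f t + b * (deriv ^^ k) g t)"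
  using assms(3)
proof (induction k)
  case (Suc k)
  have "((\<lambda>t. a * (deriv ^^ k) f t + b * (deriv ^^ k) g t) has_real_derivative
      a * (deriv ^^ Suc k) f t + b * (deriv ^^ Suc k) g t) (at t)" for t
    using Suc.prems by (intro DERIV_add DERIV_cmult funpow_deriv_has_derivative[of n] assms) auto
  then show ?case using Suc by (auto intro!: ext DERIV_imp_deriv)
qed auto

lemma funpow_deriv_affine:
  fixes f :: "real \<Rightarrow> real"
  assumes "Ck n UNIV f" "k \<le> n"
  shows "(deriv ^^ k) (\<lambda>t. f (p + c * t)) = (\<lambda>t. c ^ k * (deriv ^^ k) f (p + c * t))"
  using assms(2)
proof (induction k)
  case (Suc k)
  have "((\<lambda>t. c ^ k * (deriv ^^ k) f (p + c * t)) has_real_derivative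
      c ^ k * ((deriv ^^ Suc k) f (p + c * t) * c)) (at t)" for t
  proof (intro DERIV_cmult)
    show "((\<lambda>t. (deriv ^^ k) f (p + c * t)) has_real_derivative
        (deriv ^^ Suc k) f (p + c * t) * c) (at t)"
      using Suc.prems
      by (intro DERIV_chain2[OF funpow_deriv_has_derivative[of n]] assms)
        (auto intro!: derivative_eq_intros)
  qed
  then have "deriv (\<lambda>t. c ^ k * (deriv ^^ k) f (p + c * t)) t =
      c ^ k * ((deriv ^^ Suc k) f (p + c * t) * c)" for t
    by (rule DERIV_imp_deriv)
  then show ?case using Suc by (auto intro!: ext)
qed auto

lemma funpow_deriv_const: "(deriv ^^ k) (\<lambda>t::real. c::real) = (\<lambda>t. if k = 0 then c else 0)"
  by (induction k) auto

lemma nderiv_Suc_shift: "nderiv (Suc k) f = nderiv k (nderiv 1 f)"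
  by (induction k) auto

lemma C_on_I_Suc_iff: "C_on_I (Suc h) f \<longleftrightarrow> f differentiable_on I \<and> C_on_I h (nderiv 1 f)"
proof -
  have "(\<forall>k<Suc h. nderiv k f differentiable_on I) \<longleftrightarrow>
      f differentiable_on I \<and> (\<forall>k<h. nderiv (Suc k) f differentiable_on I)"
    by (auto simp: less_Suc_eq_0_disj)
  then show ?thesis unfolding C_on_I_def by (simp only: nderiv_Suc_shift) auto
qed

text \<open>The derivative of order \<open>h\<close> is extended by its end values; each derivative of lower order is then extended by an antiderivative of the extension of its derivative. Working with
  the extension makes the local inverses at the endpoints two-sided.\<close>
lemma C_on_I_extend:
  "C_on_I h f \<Longrightarrow> \<exists>F. Ck h UNIV F \<and> (\<forall>k\<le>h. \<forall>t\<in>I. (deriv ^^ k) F t = nderiv k f t)"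
proof (induction h arbitrary: f)
  case 0
  define F where "F t = f (max 0 (min (2 * pi) t))" for t
  have "continuous_on I f" using 0 by (simp add: C_on_I_def)
  moreover have "continuous_on UNIV (\<lambda>t. max 0 (min (2 * pi) t))"
    by (intro continuous_intros)
  moreover have "(\<lambda>t. max 0 (min (2 * pi) t)) ` UNIV \<subseteq> I" by (auto simp: I_def)
  ultimately have "continuous_on UNIV F" unfolding F_def by (rule continuous_on_compose2)
  moreover have "\<forall>t\<in>I. F t = f t" by (auto simp: F_def I_def)
  ultimately show ?case by (intro exI[of _ F]) auto
next
  case (Suc h)
  then obtain F1 where F1: "Ck h UNIV F1" "\<forall>k\<le>h. \<forall>t\<in>I. (deriv ^^ k) F1 t = nderiv k (nderiv 1 f) t"
    by (metis C_on_I_Suc_iff)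
  have "\<exists>F. \<forall>x. -\<infinity> < ereal x \<longrightarrow> ereal x < \<infinity> \<longrightarrow> (F has_vector_derivative F1 x) (at x)"
    using Ck_continuous_on[OF F1(1)]
    by (intro einterval_antiderivative) (auto simp: continuous_on_eq_continuous_at)
  then obtain F0 where F0: "\<And>x. (F0 has_vector_derivative F1 x) (at x)" by auto
  define F where "F t = F0 t - F0 0 + f 0" for t
  have dF: "(F has_vector_derivative F1 x) (at x)" for x
    unfolding F_def using F0[of x] by (auto intro!: derivative_eq_intros)
  have 1: "Ck (Suc h) UNIV F" using dF F1 by auto
  have dF': "deriv F = F1"
    using dF by (auto intro!: ext DERIV_imp_deriv simp: has_real_derivative_iff_has_vector_derivative)
  have df: "(f has_vector_derivative F1 x) (at x within I)" if "x \<in> I" for x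
  proof -
    have "f differentiable at x within I"
      using Suc.prems that by (auto simp: C_on_I_Suc_iff differentiable_on_def)
    then have "(f has_vector_derivative nderiv 1 f x) (at x within I)"
      by (simp add: vector_derivative_works)
    then show ?thesis using F1(2) that by force
  qed
  have eq: "F t = f t" if "t \<in> I" for t
  proof -
    have "((\<lambda>x. F x - f x) has_vector_derivative 0) (at x within I)" if "x \<in> I" for x
      using has_vector_derivative_diff[OF has_vector_derivative_at_within[OF dF] df[OF that]] by simp
    then obtain c where "\<And>x. x \<in> I \<Longrightarrow> F x - f x = c"
      using has_vector_derivative_zero_constant[of I "\<lambda>x. F x - f x"] by (auto simp: I_def)
    from this[of 0] this[of t] that show ?thesis by (simp add: F_def I_def)
  qed
  have "\<forall>k\<le>Suc h. \<forall>t\<in>I. (deriv ^^ k) F t = nderiv k f t"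
  proof (intro allI impI ballI)
    fix k t assume "k \<le> Suc h" "t \<in> I"
    then show "(deriv ^^ k) F t = nderiv k f t"
    proof (cases k)
      case (Suc j)
      have "(deriv ^^ k) F = (deriv ^^ j) F1" by (simp add: Suc funpow_Suc_right dF' del: funpow.simps)
      then show ?thesis using F1(2) \<open>k \<le> Suc h\<close> \<open>t \<in> I\<close> Suc by (simp only: nderiv_Suc_shift)
    qed (use eq in auto)
  qed
  with 1 show ?case by blast
qed

section \<open>Functions vanishing to high order from the right\<close>

text \<open>The branches become two-sided once the data are extended beyond the interval, so all comparisons
  can be made on the right of \<open>0\<close>, even for branches that stay in the interval on the left only. The norm reduces vector-valued functions to a real Landau
  symbol.\<close>
definition flat :: "nat \<Rightarrow> (real \<Rightarrow> 'a::real_normed_vector) \<Rightarrow> bool" where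
  "flat n f \<longleftrightarrow> (\<lambda>t. norm (f t)) \<in> o[at_right 0](\<lambda>t. t ^ n)"

lemma flat_dominated:
  assumes "flat n f" "eventually (\<lambda>t. norm (g t) \<le> C * norm (f t)) (at_right 0)"
  shows "flat n g"
proof -
  have "(\<lambda>t. norm (g t)) \<in> O[at_right 0](\<lambda>t. norm (f t))"
    using assms(2) by (intro bigoI[of _ C]) auto
  then show ?thesis using assms(1) landau_o.big_small_trans unfolding flat_def by blast
qed

lemma flat_cong:
  assumes "flat n f" "eventually (\<lambda>t. g t = f t) (at_right 0)"
  shows "flat n g"
  by (rule flat_dominated[OF assms(1), where C = 1]) (use assms(2) in eventually_elim, auto)

lemma flat_add: 
  assumes "flat n f" "flat n g"
  shows "flat n (\<lambda>t. f t + g t)"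
proof -
  have "(\<lambda>t. norm (f t) + norm (g t)) \<in> o[at_right 0](\<lambda>t. t ^ n)"
    using assms unfolding flat_def by (rule sum_in_smallo)
  then have "flat n (\<lambda>t. norm (f t) + norm (g t))" by (simp add: flat_def)
  then show ?thesis
    by (rule flat_dominated[where C = 1]) (simp add: norm_triangle_ineq)
qed

lemma flat_minus: "flat n f \<Longrightarrow> flat n (\<lambda>t. - f t)"
  by (simp add: flat_def)

lemma flat_diff: "flat n f \<Longrightarrow> flat n g \<Longrightarrow> flat n (\<lambda>t. f t - g t)"
  using flat_add[of n f "\<lambda>t. - g t"] flat_minus by auto

lemma flat_0_iff: "flat 0 f \<longleftrightarrow> (f \<longlongrightarrow> 0) (at_right 0)"
  using smalloI_tendsto[of "\<lambda>t. norm (f t)" "\<lambda>t. t ^ 0" "at_right (0::real)"]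
    smalloD_tendsto[of "\<lambda>t. norm (f t)" "at_right (0::real)" "\<lambda>t. t ^ 0"]
  by (auto simp: flat_def tendsto_norm_zero_iff) 
  

lemma flatD:
  assumes "flat n f" "\<epsilon> > 0"
  shows "eventually (\<lambda>t. norm (f t) \<le> \<epsilon> * t ^ n) (at_right 0)"
proof -
  have "eventually (\<lambda>t. norm (norm (f t)) \<le> \<epsilon> * norm (t ^ n)) (at_right (0::real))"
    using landau_o.smallD assms unfolding flat_def by blast
  moreover have "eventually (\<lambda>t. t > 0) (at_right (0::real))" by (rule eventually_at_right_less)
  ultimately show ?thesis by eventually_elim simp
qed

lemma flatI:
  assumes "\<And>\<epsilon>. \<epsilon> > 0 \<Longrightarrow> eventually (\<lambda>t. norm (f t) \<le> \<epsilon> * t ^ n) (at_right 0)"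
  shows "flat n f"
  unfolding flat_def
proof (rule landau_o.smallI)
  fix c :: real assume "c > 0"
  have "eventually (\<lambda>t. t > 0) (at_right (0::real))" by (rule eventually_at_right_less)
  with assms[OF \<open>c > 0\<close>]
  show "eventually (\<lambda>t. norm (norm (f t)) \<le> c * norm (t ^ n)) (at_right 0)" by eventually_elim simp
qed

lemma eventually_nhds_imp_at_within:
  "eventually P (nhds a) \<Longrightarrow> eventually P (at a within A)"
  unfolding eventually_at_filter by (elim eventually_mono) auto

text \<open>The mean value inequality turns a bound \<open>\<epsilon> t\<^sup>n\<close> on the derivative into a bound \<open>\<epsilon> t\<^bsup>n + 1\<^esup>\<close> on the
  function, with the same \<open>\<epsilon>\<close>.\<close>
lemma flat_integrate:
  fixes f :: "real \<Rightarrow> 'a::real_inner"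
  assumes d: "eventually (\<lambda>t. (f has_vector_derivative f' t) (at t)) (nhds 0)"
    and "f 0 = 0" and "flat n f'"
  shows "flat (Suc n) f"
proof (rule flatI)
  fix \<epsilon> :: real assume "\<epsilon> > 0"
  obtain r where r: "r > 0" "\<And>t. 0 < t \<Longrightarrow> t < r \<Longrightarrow> norm (f' t) \<le> \<epsilon> * t ^ n"
    using flatD[OF assms(3) \<open>\<epsilon> > 0\<close>] by (auto simp: eventually_at_right_field)
  obtain s where s: "s > 0" "\<And>t. dist t 0 < s \<Longrightarrow> (f has_vector_derivative f' t) (at t)"
    using d by (auto simp: eventually_nhds_metric)
  have "norm (f t) \<le> \<epsilon> * t ^ Suc n" if t: "0 < t" "t < min r s" for t
  proof -
    have "\<exists>x\<in>{0<..<t}. norm (f t - f 0) \<le> norm ((t - 0) *\<^sub>R f' x)"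
    proof (rule mvt_general[OF t(1)])
      show "continuous_on {0..t} f"
        using t by (intro continuous_at_imp_continuous_on ballI
            has_vector_derivative_continuous[OF s(2)]) auto
      show "(f has_derivative (\<lambda>y. y *\<^sub>R f' x)) (at x)" if "0 < x" "x < t" for x
        using s(2)[of x] that t by (auto simp: has_vector_derivative_def)
    qed
    then obtain x where x: "0 < x" "x < t" "norm (f t) \<le> t * norm (f' x)"
      using t assms(2) by auto
    have "norm (f' x) \<le> \<epsilon> * x ^ n" using r x t by auto
    also have "\<dots> \<le> \<epsilon> * t ^ n" using x \<open>\<epsilon> > 0\<close> by (intro mult_left_mono power_mono) auto
    finally have "t * norm (f' x) \<le> t * (\<epsilon> * t ^ n)" using t by (intro mult_left_mono) auto
    then show ?thesis using x(3) by (simp add: mult_ac)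
  qed
  then show "eventually (\<lambda>t. norm (f t) \<le> \<epsilon> * t ^ Suc n) (at_right 0)"
    using r(1) s(1) unfolding eventually_at_right_field by (intro exI[of _ "min r s"]) auto
qed

text \<open>This is the step that carries information from one side of a level to the other: the derivatives
  at \<open>0\<close> are two-sided, so they are already determined, and equal to zero, by the values on the
  left. The induction uses that the derivative also vanishes on the left.\<close>
lemma Ck_vanishing_left_flat:
  fixes f :: "real \<Rightarrow> 'a::real_inner"
  assumes "open U" "0 \<in> U"
  shows "Ck n U f \<Longrightarrow> eventually (\<lambda>t. f t = 0) (at_left 0) \<Longrightarrow> flat n f \<and> f 0 = 0"
proof (induction n arbitrary: f)
  case 0
  then have c: "isCont f 0" using assms by (simp add: continuous_on_eq_continuous_at)
  then have "(f \<longlongrightarrow> f 0) (at_left 0)" by (simp add: isCont_def filterlim_at_split)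
  moreover have "(f \<longlongrightarrow> 0) (at_left 0)" using 0(2) by (rule tendsto_eventually)
  ultimately have "f 0 = 0" using tendsto_unique[OF trivial_limit_at_left_real] by blast
  then show ?case using c by (auto simp: flat_0_iff isCont_def filterlim_at_split)
next
  case (Suc n)
  then obtain f' where d: "\<forall>x\<in>U. (f has_vector_derivative f' x) (at x)" "Ck n U f'" by auto
  have f0: "f 0 = 0" using Suc.IH[OF Ck_Suc_imp_Ck[OF Suc.prems(1)] Suc.prems(2)] by simp
  obtain b where b: "b < 0" "\<And>t. b < t \<Longrightarrow> t < 0 \<Longrightarrow> f t = 0"
    using Suc.prems(2) by (auto simp: eventually_at_left_field)
  have evU: "eventually (\<lambda>t. t \<in> U) (nhds 0)" using assms by (rule eventually_nhds_in_open)
  have evb: "eventually (\<lambda>t. b < t \<and> t < 0) (at_left 0)"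
    using b(1) unfolding eventually_at_left_field by (intro exI[of _ b]) auto
  have f'0: "eventually (\<lambda>t. f' t = 0) (at_left 0)"
    using evb eventually_nhds_imp_at_within[OF evU]
  proof (rule eventually_elim2)
    fix t assume elim: "b < t \<and> t < 0" "t \<in> U"
    have "((\<lambda>_. 0) has_vector_derivative f' t) (at t)"
    proof (rule has_vector_derivative_transform_within_open)
      show "(f has_vector_derivative f' t) (at t)" using d elim by blast
      show "open {b<..<0}" "t \<in> {b<..<0}" using elim by auto
      show "f x = 0" if "x \<in> {b<..<0}" for x using b(2) that by auto
    qed
    then show "f' t = 0"
      using vector_derivative_unique_at[OF _ has_vector_derivative_const] by blast
  qed
  have "flat n f'" using Suc.IH[OF d(2) f'0] by simp
  moreover have "eventually (\<lambda>t. (f has_vector_derivative f' t) (at t)) (nhds 0)"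
    using evU by eventually_elim (use d in auto)
  ultimately show ?case using flat_integrate[of f f' n] f0 by simp
qed

lemma flat_mono:
  assumes "flat n f" "m \<le> n" shows "flat m f"
proof (rule flatI)
  fix \<epsilon> :: real assume "\<epsilon> > 0"
  have "eventually (\<lambda>t. t > 0 \<and> t < 1) (at_right (0::real))"
    unfolding eventually_at_right_field by (intro exI[of _ 1]) auto
  with flatD[OF assms(1) \<open>\<epsilon> > 0\<close>]
  show "eventually (\<lambda>t. norm (f t) \<le> \<epsilon> * t ^ m) (at_right 0)"
  proof eventually_elim
    case (elim t)
    then have "\<epsilon> * t ^ n \<le> \<epsilon> * t ^ m"
      using \<open>\<epsilon> > 0\<close> assms(2) by (intro mult_left_mono power_decreasing) auto
    with elim show ?case by linarith
  qed
qed

lemma flat_compose: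
  assumes "flat n f" and p: "filterlim p (at_right 0) (at_right 0)"
    and le: "eventually (\<lambda>t. p t \<le> C * t) (at_right (0::real))"
  shows "flat n (\<lambda>t. f (p t))"
proof (rule flatI)
  fix \<epsilon> :: real assume "\<epsilon> > 0"
  define C' where "C' = max C 1"
  have C': "C' > 0" "C \<le> C'" by (auto simp: C'_def)
  have "\<epsilon> / C' ^ n > 0" using \<open>\<epsilon> > 0\<close> C' by simp
  from flatD[OF assms(1) this]
  have "eventually (\<lambda>t. norm (f (p t)) \<le> \<epsilon> / C' ^ n * p t ^ n) (at_right 0)"
    by (rule eventually_compose_filterlim[OF _ p])
  moreover have "eventually (\<lambda>t. p t > 0) (at_right 0)"
    by (rule eventually_compose_filterlim[OF eventually_at_right_less p])
  ultimately show "eventually (\<lambda>t. norm (f (p t)) \<le> \<epsilon> * t ^ n) (at_right 0)"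
    using le eventually_at_right_less
  proof eventually_elim
    case (elim t)
    have "p t \<le> C' * t" using elim C' mult_right_mono[of C C' t] by linarith
    then have "p t ^ n \<le> (C' * t) ^ n" using elim by (intro power_mono) auto
    then have "\<epsilon> / C' ^ n * p t ^ n \<le> \<epsilon> / C' ^ n * (C' * t) ^ n"
      using \<open>\<epsilon> > 0\<close> C' by (intro mult_left_mono) auto
    also have "\<dots> = \<epsilon> * t ^ n" using C' by (simp add: power_mult_distrib)
    finally show ?case using elim by linarith
  qed
qed

lemma flat_monomial_iff:
  fixes c :: real
  assumes "flat n (\<lambda>t. c * t ^ n)"
  shows "c = 0"
proof (rule ccontr)
  assume "c \<noteq> 0"
  then have "eventually (\<lambda>t. norm (c * t ^ n) \<le> \<bar>c\<bar> / 2 * t ^ n) (at_right 0)"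
    by (intro flatD assms) auto
  then have "eventually (\<lambda>t::real. norm (c * t ^ n) \<le> \<bar>c\<bar> / 2 * t ^ n \<and> t > 0) (at_right 0)"
    using eventually_at_right_less by (rule eventually_conj)
  then obtain t :: real where "t > 0" "norm (c * t ^ n) \<le> \<bar>c\<bar> / 2 * t ^ n"
    using eventually_happens'[OF trivial_limit_at_right_real] by blast
  then show False using \<open>c \<noteq> 0\<close> by (simp add: abs_mult)
qed

text \<open>Peano's form of Taylor's theorem at a point where only the last term survives.\<close>
lemma flat_Taylor:
  fixes f :: "real \<Rightarrow> real"
  shows "Ck n UNIV f \<Longrightarrow> (\<And>k. k < n \<Longrightarrow> (deriv ^^ k) f 0 = 0) \<Longrightarrow>
    flat n (\<lambda>t. f t - (deriv ^^ n) f 0 / fact n * t ^ n)"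
proof (induction n arbitrary: f)
  case 0
  then have "isCont f 0" by (simp add: continuous_on_eq_continuous_at)
  then have "((\<lambda>t. f t - f 0) \<longlongrightarrow> 0) (at_right 0)"
    unfolding isCont_def filterlim_at_split by (auto intro: LIM_zero)
  then show ?case by (simp add: flat_0_iff)
next
  case (Suc n)
  define c where "c = (deriv ^^ Suc n) f 0"
  have c: "c = (deriv ^^ n) (deriv f) 0" by (simp add: c_def funpow_Suc_right del: funpow.simps)
  have "flat n (\<lambda>t. deriv f t - c / fact n * t ^ n)"
    unfolding c
  proof (rule Suc.IH)
    show "Ck n UNIV (deriv f)" by (rule Ck_SucD(2)[OF Suc.prems(1)])
    show "(deriv ^^ k) (deriv f) 0 = 0" if "k < n" for k
      using Suc.prems(2)[of "Suc k"] that by (simp add: funpow_Suc_right del: funpow.simps)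
  qed
  moreover have "((\<lambda>t. f t - c / fact (Suc n) * t ^ Suc n) has_vector_derivative
      deriv f t - c / fact n * t ^ n) (at t)" for t
  proof -
    have "((\<lambda>t. c / fact (Suc n) * t ^ Suc n) has_real_derivative
        c / fact (Suc n) * (real (Suc n) * t ^ n)) (at t)"
      using DERIV_cmult[OF DERIV_pow[of "Suc n" t], of "c / fact (Suc n)"] by simp
    moreover have "c / fact (Suc n) * (real (Suc n) * t ^ n) = c / fact n * t ^ n"
      by (simp add: fact_Suc del: of_nat_Suc)
    ultimately show ?thesis
      unfolding has_real_derivative_iff_has_vector_derivative[symmetric]
      using DERIV_diff[OF Ck_SucD(1)[OF Suc.prems(1)]] by metis
  qed
  moreover have "f 0 = 0" using Suc.prems(2)[of 0] by simp
  ultimately show ?case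
    unfolding c_def[symmetric]
    by (intro flat_integrate[where f' = "\<lambda>t. deriv f t - c / fact n * t ^ n"]) auto
qed

text \<open>The first nonzero derivative would give the function the exact order of its leading monomial.\<close>
lemma flat_imp_derivs_eq_0:
  fixes f :: "real \<Rightarrow> real"
  shows "Ck n UNIV f \<Longrightarrow> flat n f \<Longrightarrow> k \<le> n \<Longrightarrow> (deriv ^^ k) f 0 = 0"
proof (induction n arbitrary: k rule: less_induct)
  case (less n)
  have lower: "(deriv ^^ j) f 0 = 0" if "j < n" for j
    using less.IH[of j j] Ck_le[OF less.prems(1)] flat_mono[OF less.prems(2)] that by auto
  have "flat n (\<lambda>t. f t - (f t - (deriv ^^ n) f 0 / fact n * t ^ n))"
    using less.prems lower by (intro flat_diff flat_Taylor) auto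
  then have "(deriv ^^ n) f 0 / fact n = 0" by (intro flat_monomial_iff[of n]) simp
  then show ?case using lower less.prems(3) by (cases "k = n") auto
qed

lemma Ck_Lipschitz:
  fixes f :: "real \<Rightarrow> real"
  assumes "Ck (Suc n) UNIV f"
  shows "\<exists>L>0. \<forall>x\<in>{-1..1}. \<forall>y\<in>{-1..1}. \<bar>f x - f y\<bar> \<le> L * \<bar>x - y\<bar>"
proof -
  have "compact (deriv f ` {-1..1})"
    using Ck_continuous_on[OF Ck_SucD(2)[OF assms]]
    by (intro compact_continuous_image) (auto intro: continuous_on_subset)
  then obtain L where L: "L > 0" "\<And>x. x \<in> {-1..1} \<Longrightarrow> \<bar>deriv f x\<bar> \<le> L"
    using compact_imp_bounded bounded_pos by (metis (no_types, lifting) imageI real_norm_def)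
  have "\<bar>f x - f y\<bar> \<le> L * \<bar>x - y\<bar>" if "x \<in> {-1..1}" "y \<in> {-1..1}" for x y
    using field_differentiable_bound[of "{-1..1}" f "deriv f" L x y] that L
      Ck_SucD(1)[OF assms] by (auto intro: has_field_derivative_at_within)
  then show ?thesis using L(1) by blast
qed

section \<open>Recovering an angle from its phase\<close>
lemma norm_cis_diff_le: "norm (cis a - cis b) \<le> \<bar>a - b\<bar>"
proof -
  have "norm (cis a - cis b) \<le> 1 * norm (a - b)"
    by (rule differentiable_bound[of UNIV cis "\<lambda>x t. t *\<^sub>R (\<i> * cis x)"])
      (use has_vector_derivative_cis in \<open>auto simp: has_vector_derivative_def onorm_scaleR_left
        norm_mult onorm_id intro!: onorm_le\<close>)
  then show ?thesis by simp
qed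

lemma eventually_abs_le_sin: "eventually (\<lambda>x. \<bar>x\<bar> \<le> 2 * \<bar>sin x\<bar>) (nhds (0::real))"
proof -
  have "((\<lambda>h. (sin (0 + h) - sin 0) / h) \<longlongrightarrow> cos 0) (at (0::real))"
    using DERIV_sin[of "0::real"] unfolding DERIV_def .
  then have "eventually (\<lambda>h. (sin (0 + h) - sin 0) / h > 1 / 2) (at (0::real))"
    by (rule order_tendstoD) simp
  then show ?thesis
    unfolding eventually_at_filter
  proof eventually_elim
    case (elim x)
    show ?case
    proof (cases "x = 0")
      case False
      then have "sin x / x > 1 / 2" using elim by auto
      then have "\<bar>sin x / x\<bar> \<ge> 1 / 2" by linarith
      then have "\<bar>sin x\<bar> / \<bar>x\<bar> \<ge> 1 / 2" by simp
      then show ?thesis using False by (simp add: field_simps)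
    qed auto
  qed
qed

text \<open>Close to \<open>u 0\<close> the angle is controlled by the sine of its increment, which is the imaginary part
  of \<open>cis (u t - u 0) - 1\<close>.\<close>
lemma flat_cis_imp_flat_angle:
  assumes "isCont u 0" "flat n (\<lambda>t. cis (u t) + c)"
  shows "cis (u 0) = - c" "flat n (\<lambda>t. u t - u 0)"
proof -
  have "((\<lambda>t. cis (u t) + c) \<longlongrightarrow> 0) (at_right 0)"
    using flat_mono[OF assms(2), of 0] by (simp add: flat_0_iff)
  moreover have ut: "(u \<longlongrightarrow> u 0) (at_right 0)"
    using assms(1) by (simp add: isCont_def filterlim_at_split)
  then have "((\<lambda>t. cis (u t) + c) \<longlongrightarrow> cis (u 0) + c) (at_right 0)"
    by (intro tendsto_intros isCont_tendsto_compose[of _ cis]) auto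
  ultimately have "cis (u 0) + c = 0"
    using tendsto_unique[OF trivial_limit_at_right_real] by blast
  then show c: "cis (u 0) = - c" by (simp add: add_eq_0_iff2)
  have "((\<lambda>t. u t - u 0) \<longlongrightarrow> 0) (at_right 0)" using ut by (rule LIM_zero)
  then have "eventually (\<lambda>t. \<bar>u t - u 0\<bar> \<le> 2 * \<bar>sin (u t - u 0)\<bar>) (at_right 0)"
    by (rule eventually_compose_filterlim[OF eventually_abs_le_sin])
  then have "eventually (\<lambda>t. norm (u t - u 0) \<le> 2 * norm (cis (u t) + c)) (at_right 0)"
  proof eventually_elim
    case (elim t)
    have "cis (u t) + c = cis (u 0) * (cis (u t - u 0) - 1)"
      using c cis_mult[of "u 0" "u t - u 0"] by (simp add: right_diff_distrib)
    then have "norm (cis (u t) + c) = norm (cis (u t - u 0) - 1)" by (simp add: norm_mult)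
    also have "\<dots> \<ge> \<bar>sin (u t - u 0)\<bar>"
      using abs_Im_le_cmod[of "cis (u t - u 0) - 1"] by simp
    finally show ?case using elim by simp
  qed
  then show "flat n (\<lambda>t. u t - u 0)" by (rule flat_dominated[OF assms(2)])
qed

section \<open>Two endpoint branches that agree to high order\<close>

text \<open>Only levels near \<open>0\<close> matter, so the domains are left to the filters \<open>nhds b\<close> and \<open>nhds 0\<close>;
  \<open>f b = 0\<close> is implicit in \<open>g 0 = b\<close> together with \<open>f (g 0) = 0\<close>.\<close>
definition local_inverse :: "(real \<Rightarrow> real) \<Rightarrow> real \<Rightarrow> (real \<Rightarrow> real) \<Rightarrow> bool" where
  "local_inverse f b g \<longleftrightarrow> g 0 = b \<and>
    (\<forall>\<^sub>F t in nhds b. g (f t) = t) \<and>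
    (\<forall>\<^sub>F y in nhds 0. f (g y) = y \<and> (g has_real_derivative inverse (deriv f (g y))) (at y))"

lemma local_inverse_isCont:
  assumes "local_inverse f b g"
  shows "isCont g 0"
proof -
  have "\<forall>\<^sub>F y in nhds 0. (g has_real_derivative inverse (deriv f (g y))) (at y)"
    using assms unfolding local_inverse_def by (elim conjE eventually_mono) blast
  then show ?thesis using DERIV_isCont eventually_nhds_x_imp_x by fast
qed

lemma at_within_le_nhds: "at x within A \<le> nhds x"
  by (simp add: at_within_def)

lemma isCont_tendsto_nhds: "isCont f a \<Longrightarrow> (f \<longlongrightarrow> f a) (nhds a)"
  by (simp add: isCont_def tendsto_at_iff_tendsto_nhds)

text \<open>The weights \<open>1 / \<psi>'(G y)\<close> and \<open>1 / \<xi>'(H y)\<close> are \<open>G' y\<close> and \<open>H' y\<close>. Both are positive near \<open>0\<close>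
  and \<open>\<bar>c\<bar> = 1\<close>, so the modulus of the combined branch dominates \<open>\<bar>G' y - H' y\<bar>\<close> whatever the
  phases are; the phases are compared only after the moduli have been identified. The shift from
  order \<open>n\<close> to order \<open>Suc n\<close> is the integration from \<open>G' - H'\<close> to \<open>G - H\<close>.\<close>
lemma branches_agree:
  fixes \<psi> \<xi> \<theta> \<eta> G H :: "real \<Rightarrow> real" and c :: real
  assumes c: "\<bar>c\<bar> = 1"
    and smooth: "Ck (Suc n) UNIV \<psi>" "Ck (Suc n) UNIV \<xi>" "Ck (Suc n) UNIV \<theta>" "Ck (Suc n) UNIV \<eta>"
    and zero: "\<psi> 0 = 0" "\<xi> 0 = 0" and pos: "deriv \<psi> 0 > 0" "deriv \<xi> 0 > 0"
    and inv: "local_inverse \<psi> 0 G" "local_inverse \<xi> 0 H"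
    and flat: "flat n (\<lambda>y. inverse (deriv \<psi> (G y)) *\<^sub>R cis (\<theta> (G y)) +
                 (c * inverse (deriv \<xi> (H y))) *\<^sub>R cis (\<eta> (H y)))"
  shows "flat (Suc n) (\<lambda>t. \<psi> t - \<xi> t)"
    and "cis (\<theta> 0 - \<eta> 0) = of_real (- c)"
    and "flat n (\<lambda>t. \<theta> t - \<eta> t - (\<theta> 0 - \<eta> 0))"
proof -
  define E where "E y = inverse (deriv \<psi> (G y)) *\<^sub>R cis (\<theta> (G y)) +
                 (c * inverse (deriv \<xi> (H y))) *\<^sub>R cis (\<eta> (H y))" for y
  define P where "P y = inverse (deriv \<psi> (G y))" for y
  define Q where "Q y = inverse (deriv \<xi> (H y))" for y
  note E = flat[folded E_def[abs_def]]
  have G0: "G 0 = 0" "H 0 = 0" using inv by (auto simp: local_inverse_def)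
  have contD: "isCont (deriv \<psi>) x" "isCont (deriv \<xi>) x" for x
    using smooth[THEN Ck_SucD(2), THEN Ck_continuous_on]
    by (auto simp: continuous_on_eq_continuous_at)
  have cont: "isCont \<psi> x" "isCont \<xi> x" "isCont \<theta> x" "isCont \<eta> x" for x
    using smooth[THEN Ck_continuous_on] by (auto simp: continuous_on_eq_continuous_at)
  have contGH: "isCont G 0" "isCont H 0" using inv local_inverse_isCont by blast+
  have GH0: "(G \<longlongrightarrow> 0) (nhds 0)" "(H \<longlongrightarrow> 0) (nhds 0)"
    using contGH[THEN isCont_tendsto_nhds] G0 by simp_all
  have ev_pos: "\<forall>\<^sub>F t in nhds 0. deriv \<psi> t > 0" "\<forall>\<^sub>F t in nhds 0. deriv \<xi> t > 0"
    using contD[of 0, THEN isCont_tendsto_nhds] pos order_tendstoD(1) by blast+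
  have ev_P: "\<forall>\<^sub>F y in nhds 0. P y > 0" "\<forall>\<^sub>F y in nhds 0. Q y > 0"
    unfolding P_def Q_def using eventually_compose_filterlim[OF ev_pos(1) GH0(1)]
      eventually_compose_filterlim[OF ev_pos(2) GH0(2)] by simp_all
  have PQ: "flat n (\<lambda>y. P y - Q y)"
  proof (rule flat_dominated[OF E, where C = 1])
    have "\<forall>\<^sub>F y in nhds 0. norm (P y - Q y) \<le> 1 * norm (E y)" using ev_P
    proof eventually_elim
      case (elim y)
      have "\<bar>norm (P y *\<^sub>R cis (\<theta> (G y))) - norm (- ((c * Q y) *\<^sub>R cis (\<eta> (H y))))\<bar> \<le>
          norm (P y *\<^sub>R cis (\<theta> (G y)) - - ((c * Q y) *\<^sub>R cis (\<eta> (H y))))"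
        by (rule norm_triangle_ineq3)
      then show ?case using elim c by (simp add: E_def P_def Q_def abs_mult)
    qed
    then show "\<forall>\<^sub>F y in at_right 0. norm (P y - Q y) \<le> 1 * norm (E y)"
      by (rule eventually_nhds_imp_at_within)
  qed
  have GH: "flat (Suc n) (\<lambda>y. G y - H y)"
  proof (rule flat_integrate[OF _ _ PQ])
    have "\<forall>\<^sub>F y in nhds 0. (G has_real_derivative P y) (at y)"
         "\<forall>\<^sub>F y in nhds 0. (H has_real_derivative Q y) (at y)"
      using inv unfolding local_inverse_def P_def Q_def
      by (elim conjE eventually_mono; blast)+
    then show "\<forall>\<^sub>F y in nhds 0. ((\<lambda>y. G y - H y) has_vector_derivative P y - Q y) (at y)"
      unfolding has_real_derivative_iff_has_vector_derivative
      by eventually_elim (rule has_vector_derivative_diff)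
  qed (use G0 in simp)
  \<comment> \<open>To pass from the level \<open>y\<close> back to the parameter \<open>t\<close>, substitute \<open>y = \<psi> t\<close>: then
    \<open>G y = t\<close>, and \<open>\<psi>\<close> is comparable to \<open>t\<close>, so that orders of vanishing are preserved.\<close>
  obtain L where L: "L > 0" "\<And>x y. \<bar>x\<bar> \<le> 1 \<Longrightarrow> \<bar>y\<bar> \<le> 1 \<Longrightarrow> \<bar>\<psi> x - \<psi> y\<bar> \<le> L * \<bar>x - y\<bar>"
    using Ck_Lipschitz[OF smooth(1)] by (auto simp: abs_le_iff)
  obtain M where M: "M > 0" "\<And>x y. \<bar>x\<bar> \<le> 1 \<Longrightarrow> \<bar>y\<bar> \<le> 1 \<Longrightarrow> \<bar>\<xi> x - \<xi> y\<bar> \<le> M * \<bar>x - y\<bar>"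
    using Ck_Lipschitz[OF smooth(2)] by (auto simp: abs_le_iff)
  obtain N where N: "N > 0" "\<And>x y. \<bar>x\<bar> \<le> 1 \<Longrightarrow> \<bar>y\<bar> \<le> 1 \<Longrightarrow> \<bar>\<eta> x - \<eta> y\<bar> \<le> N * \<bar>x - y\<bar>"
    using Ck_Lipschitz[OF smooth(4)] by (auto simp: abs_le_iff)
  have psi0: "(\<psi> \<longlongrightarrow> 0) (nhds 0)"
    using isCont_tendsto_nhds[OF cont(1)[of 0]] zero by simp
  have small: "\<forall>\<^sub>F t in nhds 0. \<bar>t\<bar> \<le> (1::real)"
    unfolding eventually_nhds_metric by (intro exI[of _ 1]) (auto simp: dist_real_def)
  have psi_pos: "\<forall>\<^sub>F t in at_right 0. \<psi> t > 0"
  proof -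
    obtain d where d: "d > 0" "\<And>t. dist t 0 < d \<Longrightarrow> deriv \<psi> t > 0"
      using ev_pos(1) by (auto simp: eventually_nhds_metric)
    have "\<psi> t > 0" if "0 < t" "t < d" for t
    proof -
      have "\<psi> 0 < \<psi> t"
      proof (rule DERIV_pos_imp_increasing[OF that(1)])
        fix x assume "0 \<le> x" "x \<le> t"
        then show "\<exists>y. (\<psi> has_real_derivative y) (at x) \<and> 0 < y"
          using Ck_SucD(1)[OF smooth(1), of x] d(2)[of x] that by (auto simp: dist_real_def)
      qed
      then show ?thesis using zero by simp
    qed
    then show ?thesis unfolding eventually_at_right_field using d(1) by blast
  qed
  have psi_lim: "filterlim \<psi> (at_right 0) (at_right 0)"
    using psi_pos tendsto_mono[OF at_within_le_nhds psi0]
    by (auto simp: filterlim_at elim: eventually_mono)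
  have psi_le: "\<forall>\<^sub>F t in at_right 0. \<psi> t \<le> L * t"
    using eventually_nhds_imp_at_within[OF small, of "{0<..}"] eventually_at_right_less[of 0]
  proof eventually_elim
    case (elim t)
    then show ?case using L(2)[of t 0] zero by simp
  qed
  note subst = flat_compose[OF _ psi_lim psi_le]
  have near: "\<forall>\<^sub>F t in nhds 0. \<bar>t\<bar> \<le> 1 \<and> \<bar>H (\<psi> t)\<bar> \<le> 1 \<and> G (\<psi> t) = t \<and> \<xi> (H (\<psi> t)) = \<psi> t"
  proof -
    have H\<xi>: "\<forall>\<^sub>F y in nhds 0. \<xi> (H y) = y"
      using inv(2) unfolding local_inverse_def by (elim conjE eventually_mono) blast
    have G\<psi>: "\<forall>\<^sub>F t in nhds 0. G (\<psi> t) = t"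
      using inv(1) unfolding local_inverse_def by blast
    from eventually_compose_filterlim[OF H\<xi> psi0]
      eventually_compose_filterlim[OF eventually_compose_filterlim[OF small GH0(2)] psi0] small G\<psi>
    show ?thesis by eventually_elim blast
  qed
  note near' = eventually_nhds_imp_at_within[OF near, of "{0<..}"]
  show "flat (Suc n) (\<lambda>t. \<psi> t - \<xi> t)"
  proof (rule flat_dominated[OF subst[OF GH], where C = M])
    show "\<forall>\<^sub>F t in at_right 0. norm (\<psi> t - \<xi> t) \<le> M * norm (G (\<psi> t) - H (\<psi> t))"
      using near'
    proof eventually_elim
      case (elim t)
      \<comment> \<open>\<open>\<psi> t - \<xi> t = \<xi> (H (\<psi> t)) - \<xi> (G (\<psi> t))\<close>\<close>
      then show ?case using M(2)[of t "H (\<psi> t)"] by (simp add: abs_minus_commute)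
    qed
  qed
  define R where "R y = norm (E y) + norm (P y - Q y) + norm (G y - H y)" for y
  have "flat n R" unfolding R_def
    using flat_mono[OF GH, of n] PQ E by (intro flat_add) (auto simp: flat_def)
  then have R: "flat n (\<lambda>t. R (\<psi> t))" by (rule subst)
  have "flat n (\<lambda>t. cis (\<theta> t - \<eta> t) + of_real c)"
  proof (rule flat_dominated[OF R, where C = "deriv \<psi> 0 + 1 + N"])
    have "\<forall>\<^sub>F t in nhds 0. deriv \<psi> t < deriv \<psi> 0 + 1"
      by (rule order_tendstoD(2)[OF isCont_tendsto_nhds[OF contD(1)]]) simp
    with near ev_pos(1)
    have "\<forall>\<^sub>F t in nhds 0. norm (cis (\<theta> t - \<eta> t) + of_real c) \<le> (deriv \<psi> 0 + 1 + N) * norm (R (\<psi> t))"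
    proof eventually_elim
      case (elim t)
      define y where "y = \<psi> t"
      define p where "p = deriv \<psi> t"
      have Gy: "G y = t" using elim by (simp add: y_def)
      have p: "p > 0" "p < deriv \<psi> 0 + 1" "P y = inverse p" using elim Gy by (auto simp: p_def P_def)
      have "norm (cis (\<theta> t - \<eta> t) + of_real c) = norm (cis (\<eta> t) * (cis (\<theta> t - \<eta> t) + of_real c))"
        by (simp add: norm_mult)
      also have "cis (\<eta> t) * (cis (\<theta> t - \<eta> t) + of_real c) = cis (\<theta> t) + c *\<^sub>R cis (\<eta> t)"
        by (simp add: algebra_simps cis_mult scaleR_conv_of_real)
      \<comment> \<open>Since \<open>P y = 1 / p\<close>, the three terms are the combined branch, the defect of the
        moduli and the defect of the arguments of \<open>\<eta>\<close>; each is bounded by \<open>R\<close>.\<close>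
      also have "\<dots> = p *\<^sub>R E y + (c * (p * (P y - Q y))) *\<^sub>R cis (\<eta> (H y)) +
          c *\<^sub>R (cis (\<eta> t) - cis (\<eta> (H y)))"
        using p(1) by (simp add: E_def Gy p_def[symmetric] p(3) Q_def[symmetric] algebra_simps)
      also have "norm \<dots> \<le> norm (p *\<^sub>R E y) + norm ((c * (p * (P y - Q y))) *\<^sub>R cis (\<eta> (H y))) +
          norm (c *\<^sub>R (cis (\<eta> t) - cis (\<eta> (H y))))"
        by (intro norm_triangle_le add_mono order_refl norm_triangle_ineq)
      also have "\<dots> = p * norm (E y) + p * \<bar>P y - Q y\<bar> + norm (cis (\<eta> t) - cis (\<eta> (H y)))"
        using c p by (simp add: abs_mult)
      also have "\<dots> \<le> (deriv \<psi> 0 + 1) * norm (E y) + (deriv \<psi> 0 + 1) * \<bar>P y - Q y\<bar> + N * \<bar>G y - H y\<bar>"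
      proof (intro add_mono mult_right_mono)
        show "norm (cis (\<eta> t) - cis (\<eta> (H y))) \<le> N * \<bar>G y - H y\<bar>"
          using norm_cis_diff_le[of "\<eta> t" "\<eta> (H y)"] N(2)[of t "H y"] elim Gy by (simp add: y_def)
      qed (use p in auto)
      also have "\<dots> \<le> (deriv \<psi> 0 + 1 + N) * R y"
        unfolding R_def using pos(1) N(1) by (simp add: algebra_simps)
      also have "R y = norm (R (\<psi> t))" by (simp add: R_def y_def)
      finally show ?case .
    qed
    then show "\<forall>\<^sub>F t in at_right 0. norm (cis (\<theta> t - \<eta> t) + of_real c) \<le> (deriv \<psi> 0 + 1 + N) * norm (R (\<psi> t))"
      by (rule eventually_nhds_imp_at_within)
  qed
  from flat_cis_imp_flat_angle[OF _ this]
  show "cis (\<theta> 0 - \<eta> 0) = of_real (- c)" "flat n (\<lambda>t. \<theta> t - \<eta> t - (\<theta> 0 - \<eta> 0))"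
    using cont by (auto intro: continuous_intros)
qed

section \<open>Level sets near a regular value\<close>

text \<open>The inverse function theorem gives a differentiable inverse. Its derivative is
  \<open>1 / f'(g y)\<close>, which is as smooth as \<open>g\<close> as long as \<open>f'\<close> is; this raises the class of \<open>g\<close> one
  step at a time up to that of \<open>f\<close>.\<close>
lemma inverse_branch:
  assumes f: "Ck (Suc n) UNIV f" and b: "f b = 0" "deriv f b \<noteq> 0"
  obtains U V g where "open U" "b \<in> U" "open V" "0 \<in> V" "homeomorphism U V f g"
    "Ck (Suc n) V g" "\<And>y. y \<in> V \<Longrightarrow> deriv f (g y) \<noteq> 0" "local_inverse f b g"
proof -
  have contD: "continuous_on A (deriv f)" for A
    using Ck_continuous_on[OF Ck_SucD(2)[OF f]] by (rule continuous_on_subset) simp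
  define U0 where "U0 = {x. deriv f x \<noteq> 0}"
  have "open U0"
    unfolding U0_def using contD by (intro open_Collect_neq continuous_intros)
  moreover have "(f has_derivative blinfun_apply (blinfun_mult_right (deriv f x))) (at x)" for x
    using Ck_SucD(1)[OF f, of x] by (simp add: has_field_derivative_def)
  moreover have "continuous_on U0 (\<lambda>x. blinfun_mult_right (deriv f x))"
    using contD by (intro bounded_linear.continuous_on[OF bounded_linear_blinfun_mult_right])
  moreover have "b \<in> U0" using b by (simp add: U0_def)
  moreover have "blinfun_mult_right (inverse (deriv f b)) o\<^sub>L blinfun_mult_right (deriv f b) = id_blinfun"
    using b by (intro blinfun_eqI) simp
  ultimately obtain U V g g' where UV: "open U" "U \<subseteq> U0" "b \<in> U" "open V" "f b \<in> V"
      "homeomorphism U V f g" and g': "\<And>y. y \<in> V \<Longrightarrow> (g has_derivative (g' y)) (at y)"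
      "\<And>y. y \<in> V \<Longrightarrow> g' y = inv (blinfun_apply (blinfun_mult_right (deriv f (g y))))"
    by (rule inverse_function_theorem) (rule that)
  have ne: "deriv f (g y) \<noteq> 0" if "y \<in> V" for y
    using UV(2,6) that by (auto simp: U0_def homeomorphism_def)
  have dg: "(g has_real_derivative inverse (deriv f (g y))) (at y)" if "y \<in> V" for y
  proof -
    have "g' y = (*) (inverse (deriv f (g y)))"
      unfolding g'(2)[OF that] using ne[OF that] by (intro inv_equality) auto
    then show ?thesis using g'(1)[OF that] by (simp add: has_field_derivative_def)
  qed
  have "Ck m V g" if "m \<le> Suc n" for m
    using that
  proof (induction m)
    case 0
    then show ?case using UV(6) by (simp add: homeomorphism_def)
  next
    case (Suc m)
    have "Ck m UNIV (deriv f)" using Ck_le[OF Ck_SucD(2)[OF f]] Suc.prems by simp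
    moreover have "Ck m V g" using Suc by simp
    ultimately have "Ck m V (\<lambda>y. deriv f (g y))"
      using Ck_compose[of m V g UNIV "deriv f"] by simp
    then have "Ck m V (\<lambda>y. inverse (deriv f (g y)))" 
      by (rule Ck_inverse[of m V "\<lambda>y. deriv f (g y)"]) (rule ne)
    then show ?case using dg
      unfolding Ck.simps has_real_derivative_iff_has_vector_derivative
      by (intro exI[of _ "\<lambda>y. inverse (deriv f (g y))"]) simp
  qed
  then have "Ck (Suc n) V g" by blast
  moreover have "local_inverse f b g"
    unfolding local_inverse_def
  proof (intro conjI)
    show "g 0 = b" using UV(3,6) b by (metis homeomorphism_apply1)
    show "\<forall>\<^sub>F t in nhds b. g (f t) = t"
      using eventually_nhds_in_open[OF UV(1,3)]
      by eventually_elim (use UV(6) homeomorphism_apply1 in blast)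
    have "\<forall>\<^sub>F y in nhds 0. y \<in> V" using UV(4,5) b by (intro eventually_nhds_in_open) auto
    then show "\<forall>\<^sub>F y in nhds 0. f (g y) = y \<and> (g has_real_derivative inverse (deriv f (g y))) (at y)"
      by eventually_elim (use UV(6) homeomorphism_apply2 dg in blast)
  qed
  ultimately show ?thesis using that[of U V g] UV ne b by auto
qed

lemma local_inverse_tendsto:
  assumes "local_inverse f b g" shows "(g \<longlongrightarrow> b) (nhds 0)"
  using isCont_tendsto_nhds[OF local_inverse_isCont[OF assms]] assms by (simp add: local_inverse_def)

text \<open>Zeros in the compact set \<open>K\<close> are isolated by the domains of the local inverses, hence finite in
  number. Outside these domains \<open>\<bar>f\<bar>\<close> is bounded below, so for small \<open>y\<close> every preimage lies on a
  branch. Branches start at distinct points, so their values at a common small \<open>y\<close> are distinct. A branch issuing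
  from a boundary point may leave \<open>K\<close>, hence the condition \<open>g b y \<in> K\<close>.\<close>
lemma level_sets_near_zero:
  assumes f: "Ck (Suc n) UNIV f" and "compact K"
    and reg: "\<And>b. b \<in> K \<Longrightarrow> f b = 0 \<Longrightarrow> deriv f b \<noteq> 0"
  defines "Z \<equiv> {b \<in> K. f b = 0}"
  obtains V g where "finite Z"
    "\<And>b. b \<in> Z \<Longrightarrow> open (V b) \<and> 0 \<in> V b \<and> Ck (Suc n) (V b) (g b) \<and> local_inverse f b (g b) \<and>
        (\<forall>y\<in>V b. deriv f (g b y) \<noteq> 0)"
    "\<forall>\<^sub>F y in nhds 0. inj_on (\<lambda>b. g b y) Z \<and> {t \<in> K. f t = y} = (\<lambda>b. g b y) ` {b \<in> Z. g b y \<in> K}"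
proof -
  have "\<forall>b\<in>Z. \<exists>U V g. open U \<and> b \<in> U \<and> open V \<and> 0 \<in> V \<and> homeomorphism U V f g \<and>
      Ck (Suc n) V g \<and> (\<forall>y\<in>V. deriv f (g y) \<noteq> 0) \<and> local_inverse f b g"
  proof
    fix b assume "b \<in> Z"
    then have fb: "f b = 0" "deriv f b \<noteq> 0" using reg by (auto simp: Z_def)
    obtain U V g where UVg: "open U" "b \<in> U" "open V" "0 \<in> V" "homeomorphism U V f g"
      "Ck (Suc n) V g" "\<And>y. y \<in> V \<Longrightarrow> deriv f (g y) \<noteq> 0" "local_inverse f b g"
      by (rule inverse_branch[OF f fb]) (rule that)
    show "\<exists>U V g. open U \<and> b \<in> U \<and> open V \<and> 0 \<in> V \<and> homeomorphism U V f g \<and>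
        Ck (Suc n) V g \<and> (\<forall>y\<in>V. deriv f (g y) \<noteq> 0) \<and> local_inverse f b g"
      by (intro exI[of _ U] exI[of _ V] exI[of _ g]) (simp add: UVg del: Ck.simps)
  qed
  then obtain U V g where UVg: "\<And>b. b \<in> Z \<Longrightarrow> open (U b) \<and> b \<in> U b \<and> open (V b) \<and> 0 \<in> V b \<and>
      homeomorphism (U b) (V b) f (g b) \<and> Ck (Suc n) (V b) (g b) \<and>
      (\<forall>y\<in>V b. deriv f (g b y) \<noteq> 0) \<and> local_inverse f b (g b)"
    unfolding bchoice_iff by metis
  have contf: "continuous_on A f" for A
    using Ck_continuous_on[OF f] by (rule continuous_on_subset) simp
  have gf: "g b (f t) = t" if "b \<in> Z" "t \<in> U b" for b t
    using UVg[OF that(1)] that(2) homeomorphism_apply1 by metis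
  have "closed {b. f b = 0}" by (intro closed_Collect_eq contf continuous_on_const)
  then have "compact Z" unfolding Z_def Collect_conj_eq Collect_mem_eq
    using \<open>compact K\<close> by (intro compact_Int_closed)
  then obtain D where D: "D \<subseteq> Z" "finite D" "Z \<subseteq> (\<Union>b\<in>D. U b)"
    by (rule compactE_image[of Z Z U]) (use UVg in auto)
  have "Z \<subseteq> D"
  proof
    fix z assume z: "z \<in> Z"
    then obtain b where b: "b \<in> D" "z \<in> U b" using D by auto
    have "z = g b 0" using gf[of b z] b D z by (auto simp: Z_def)
    also have "\<dots> = b" using gf[of b b] b D UVg[of b] by (auto simp: Z_def)
    finally show "z \<in> D" using b by simp
  qed
  then have fin: "finite Z" using D finite_subset by blast
  have "\<forall>\<^sub>F y in nhds 0. \<forall>b\<in>Z. y \<in> V b"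
    using fin UVg by (intro eventually_ball_finite ballI eventually_nhds_in_open) auto
  moreover have "\<forall>\<^sub>F y in nhds 0. y \<notin> f ` (K - (\<Union>b\<in>Z. U b))"
  proof -
    have "open (\<Union>b\<in>Z. U b)" using UVg by auto
    then have "compact (f ` (K - (\<Union>b\<in>Z. U b)))"
      using \<open>compact K\<close> by (intro compact_continuous_image contf compact_diff)
    then have "open (- f ` (K - (\<Union>b\<in>Z. U b)))" using compact_imp_closed by blast
    moreover have "0 \<in> - f ` (K - (\<Union>b\<in>Z. U b))" using UVg by (auto simp: Z_def)
    ultimately have "\<forall>\<^sub>F y in nhds 0. y \<in> - f ` (K - (\<Union>b\<in>Z. U b))" by (rule eventually_nhds_in_open)
    then show ?thesis by simp
  qed
  moreover have "\<forall>\<^sub>F y in nhds 0. \<forall>b\<in>Z. \<forall>c\<in>Z. b \<noteq> c \<longrightarrow> g b y \<noteq> g c y"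
  proof (intro eventually_ball_finite[OF fin] ballI)
    fix b c assume bc: "b \<in> Z" "c \<in> Z"
    have *: "((\<lambda>y. g b y - g c y) \<longlongrightarrow> b - c) (nhds 0)"
      using UVg bc by (intro tendsto_diff local_inverse_tendsto[of f]) auto
    show "\<forall>\<^sub>F y in nhds 0. b \<noteq> c \<longrightarrow> g b y \<noteq> g c y"
    proof (cases "b = c")
      case False
      then show ?thesis using tendsto_imp_eventually_ne[OF *, of 0] by simp
    qed simp
  qed
  ultimately have "\<forall>\<^sub>F y in nhds 0. inj_on (\<lambda>b. g b y) Z \<and>
      {t \<in> K. f t = y} = (\<lambda>b. g b y) ` {b \<in> Z. g b y \<in> K}"
  proof eventually_elim
    case (elim y)
    have fg: "f (g b y) = y" if "b \<in> Z" for b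
      using elim(1) UVg[OF that] that homeomorphism_apply2 by metis
    have ex: "\<exists>b\<in>Z. t = g b y" if t: "t \<in> K" "f t = y" for t
    proof -
      obtain b where "b \<in> Z" "t \<in> U b" using elim(2) t by blast
      then show ?thesis using gf[of b t] t by auto
    qed
    show ?case
    proof (intro conjI equalityI subsetI)
      show "inj_on (\<lambda>b. g b y) Z" by (rule inj_onI) (use elim(3) in blast)
      fix t assume "t \<in> {t \<in> K. f t = y}"
      then have t: "t \<in> K" "f t = y" by simp_all
      then obtain b where "b \<in> Z" "t = g b y" using ex by blast
      with t(1) show "t \<in> (\<lambda>b. g b y) ` {b \<in> Z. g b y \<in> K}" by simp
    next
      fix t assume "t \<in> (\<lambda>b. g b y) ` {b \<in> Z. g b y \<in> K}"
      then obtain b where "b \<in> Z" "t = g b y" "t \<in> K" by blast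
      then show "t \<in> {t \<in> K. f t = y}" using fg by simp
    qed
  qed
  then show ?thesis by (intro that[of V g] fin) (use UVg in simp_all)
qed

text \<open>These decide on which side of level \<open>0\<close> a branch issuing from an endpoint lies in the interval.\<close>
lemma eventually_inverse_side:
  assumes "local_inverse f b g"
  shows "deriv f b > 0 \<Longrightarrow> \<forall>\<^sub>F y in at_right 0. g y > b"
    and "deriv f b > 0 \<Longrightarrow> \<forall>\<^sub>F y in at_left 0. g y < b"
    and "deriv f b < 0 \<Longrightarrow> \<forall>\<^sub>F y in at_right 0. g y < b"
    and "deriv f b < 0 \<Longrightarrow> \<forall>\<^sub>F y in at_left 0. g y > b"
proof -
  have g0: "g 0 = b" using assms by (simp add: local_inverse_def)
  have "\<forall>\<^sub>F y in nhds 0. (g has_real_derivative inverse (deriv f (g y))) (at y)"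
    using assms unfolding local_inverse_def by (elim conjE eventually_mono) blast
  then have d: "(g has_real_derivative inverse (deriv f b)) (at 0)"
    using eventually_nhds_x_imp_x g0 by fastforce
  have right: "\<forall>\<^sub>F y in at_right 0. P y" if "\<exists>d>0. \<forall>h>0. h < d \<longrightarrow> P (0 + h)" for P :: "real \<Rightarrow> bool"
    using that unfolding eventually_at_right_field by simp
  have left: "\<forall>\<^sub>F y in at_left 0. P y" if ex: "\<exists>d>0. \<forall>h>0. h < d \<longrightarrow> P (0 - h)" for P :: "real \<Rightarrow> bool"
  proof -
    obtain d where "d > 0" "\<And>h. h > 0 \<Longrightarrow> h < d \<Longrightarrow> P (0 - h)" using ex by blast
    note d = this
    show ?thesis unfolding eventually_at_left_field
    proof (intro exI[of _ "- d"] conjI allI impI)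
      show "- d < 0" using d(1) by simp
      show "P y" if "- d < y" "y < 0" for y
      proof -
        have "P (0 - (- y))" by (rule d(2)) (use that in linarith)+
        then show ?thesis by simp
      qed
    qed
  qed
  have pos: "inverse (deriv f b) > 0" if "deriv f b > 0" using that by simp
  have neg: "inverse (deriv f b) < 0" if "deriv f b < 0" using that by simp
  show "\<forall>\<^sub>F y in at_right 0. g y > b" if "deriv f b > 0"
    by (rule right) (use DERIV_pos_inc_right[OF d pos[OF that]] g0 in simp)
  show "\<forall>\<^sub>F y in at_left 0. g y < b" if "deriv f b > 0"
    by (rule left) (use DERIV_pos_inc_left[OF d pos[OF that]] g0 in simp)
  show "\<forall>\<^sub>F y in at_right 0. g y < b" if "deriv f b < 0"
    by (rule right) (use DERIV_neg_dec_right[OF d neg[OF that]] g0 in simp)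
  show "\<forall>\<^sub>F y in at_left 0. g y > b" if "deriv f b < 0"
    by (rule left) (use DERIV_neg_dec_left[OF d neg[OF that]] g0 in simp)
qed

lemma deriv_affine:
  fixes f :: "real \<Rightarrow> real"
  assumes "Ck (Suc n) UNIV f"
  shows "deriv (\<lambda>t. f (p + c * t)) t = c * deriv f (p + c * t)"
  using fun_cong[OF funpow_deriv_affine[OF assms, of 1 p c]] by simp

lemma local_inverse_reflect:
  assumes f: "Ck (Suc n) UNIV f" and g: "local_inverse f p g" and c: "c * c = 1"
  shows "local_inverse (\<lambda>t. f (p + c * t)) 0 (\<lambda>y. c * (g y - p))"
  unfolding local_inverse_def
proof (intro conjI)
  have cc: "c * (c * x) = x" for x by (simp add: mult.assoc[symmetric] c)
  have ci: "inverse c = c" using c by (metis inverse_unique)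
  show "c * (g 0 - p) = 0" using g by (simp add: local_inverse_def)
  have "isCont (\<lambda>t. p + c * t) 0" by (intro continuous_intros)
  then have "((\<lambda>t. p + c * t) \<longlongrightarrow> p) (nhds 0)" using isCont_tendsto_nhds by fastforce
  moreover have "\<forall>\<^sub>F t in nhds p. g (f t) = t" using g by (simp add: local_inverse_def)
  ultimately have "\<forall>\<^sub>F t in nhds 0. g (f (p + c * t)) = p + c * t"
    by (rule eventually_compose_filterlim[rotated])
  then show "\<forall>\<^sub>F t in nhds 0. c * (g (f (p + c * t)) - p) = t"
    by eventually_elim (simp add: cc)
  have "\<forall>\<^sub>F y in nhds 0. f (g y) = y \<and> (g has_real_derivative inverse (deriv f (g y))) (at y)"
    using g by (simp add: local_inverse_def)
  then show "\<forall>\<^sub>F y in nhds 0. f (p + c * (c * (g y - p))) = y \<and>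
      ((\<lambda>y. c * (g y - p)) has_real_derivative
        inverse (deriv (\<lambda>t. f (p + c * t)) (c * (g y - p)))) (at y)"
  proof eventually_elim
    case (elim y)
    have "((\<lambda>y. c * (g y - p)) has_real_derivative c * inverse (deriv f (g y))) (at y)"
      using elim by (auto intro!: derivative_eq_intros)
    then show ?case using elim by (simp add: deriv_affine[OF f] cc ci)
  qed
qed

section \<open>The branches at the two endpoints\<close>

text \<open>The derivative \<open>\<psi>' (g y)\<close> is not replaced by its modulus: its sign is exactly the sign with which
  the second endpoint branch enters. If \<open>\<psi>' p < 0\<close>, both endpoint branches are present for \<open>y > 0\<close>
  and their sum is flat. If \<open>\<psi>' p > 0\<close>, they are present on opposite sides, complete the same
  interior sum to zero, and their difference is flat.\<close>
lemma endpoint_branches_cancel: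
  fixes \<psi> \<theta> :: "real \<Rightarrow> real" and p :: real
  assumes p: "p > 0" and smooth: "Ck (Suc n) UNIV \<psi>" "Ck (Suc n) UNIV \<theta>"
    and \<psi>0: "\<psi> 0 = 0" "deriv \<psi> 0 > 0"
    and reg: "\<And>t. t \<in> {0..p} \<Longrightarrow> \<psi> t = 0 \<Longrightarrow> deriv \<psi> t \<noteq> 0"
    and sum0: "\<And>y. (\<And>t. t \<in> {0..p} \<Longrightarrow> \<psi> t = y \<Longrightarrow> deriv \<psi> t \<noteq> 0) \<Longrightarrow> y \<noteq> 0 \<Longrightarrow> y \<noteq> \<psi> p \<Longrightarrow>
      (\<Sum>b\<in>{t \<in> {0..p}. \<psi> t = y}. (1 / \<bar>deriv \<psi> b\<bar>) *\<^sub>R cis (\<theta> b)) = 0"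
  obtains G g where "\<psi> p = 0" "local_inverse \<psi> 0 G" "local_inverse \<psi> p g"
    "flat n (\<lambda>y. inverse (deriv \<psi> (G y)) *\<^sub>R cis (\<theta> (G y)) -
        inverse (deriv \<psi> (g y)) *\<^sub>R cis (\<theta> (g y)))"
proof -
  define Z where "Z = {b \<in> {0..p}. \<psi> b = 0}"
  obtain V g where fin: "finite Z" and
    g: "\<And>b. b \<in> Z \<Longrightarrow> open (V b) \<and> 0 \<in> V b \<and> Ck (Suc n) (V b) (g b) \<and>
          local_inverse \<psi> b (g b) \<and> (\<forall>y\<in>V b. deriv \<psi> (g b y) \<noteq> 0)" and
    level: "\<forall>\<^sub>F y in nhds 0. inj_on (\<lambda>b. g b y) Z \<and>
        {t \<in> {0..p}. \<psi> t = y} = (\<lambda>b. g b y) ` {b \<in> Z. g b y \<in> {0..p}}"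
    by (rule level_sets_near_zero[OF smooth(1) compact_Icc[of 0 p], folded Z_def])
      (erule (1) reg, rule that)
  \<comment> \<open>The sign of \<open>\<psi>'\<close> is frozen at \<open>b\<close>, so that \<open>F b\<close> is visibly smooth; near level \<open>0\<close> it
    is the summand of the hypothesis.\<close>
  define F where "F b y = (sgn (deriv \<psi> b) * inverse (deriv \<psi> (g b y))) *\<^sub>R cis (\<theta> (g b y))" for b y
  have Z0: "0 \<in> Z" using p \<psi>0 by (simp add: Z_def)
  have dZ: "deriv \<psi> b \<noteq> 0" if "b \<in> Z" for b using reg that by (simp add: Z_def)
  have cont_d: "isCont (deriv \<psi>) t" for t
    using Ck_continuous_on[OF Ck_SucD(2)[OF smooth(1)]] by (simp add: continuous_on_eq_continuous_at)
  have lim: "(g b \<longlongrightarrow> b) (nhds 0)" if "b \<in> Z" for b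
    using local_inverse_tendsto g[OF that] by blast
  have lim_d: "((\<lambda>y. deriv \<psi> (g b y)) \<longlongrightarrow> deriv \<psi> b) (nhds 0)" if "b \<in> Z" for b
    by (rule isCont_tendsto_compose[OF cont_d lim[OF that]])
  have CkF: "Ck n (V b) (F b)" if "b \<in> Z" for b
  proof -
    have gb: "Ck n (V b) (g b)" using g[OF that] Ck_Suc_imp_Ck by blast
    have "Ck n (V b) (\<lambda>y. deriv \<psi> (g b y))"
      using Ck_compose[OF gb _ Ck_SucD(2)[OF smooth(1)]] by simp
    then have "Ck n (V b) (\<lambda>y. inverse (deriv \<psi> (g b y)))"
      by (rule Ck_inverse[of n "V b" "\<lambda>y. deriv \<psi> (g b y)"]) (use g[OF that] in blast)
    then have 1: "Ck n (V b) (\<lambda>y. sgn (deriv \<psi> b) * inverse (deriv \<psi> (g b y)))"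
      by (rule Ck_mult[OF Ck_const])
    have "Ck n (V b) (\<lambda>y. \<theta> (g b y))"
      using Ck_compose[OF gb _ Ck_Suc_imp_Ck[OF smooth(2)]] by simp
    then have "Ck n (V b) (\<lambda>y. cis (\<theta> (g b y)))"
      using Ck_compose[of n "V b" "\<lambda>y. \<theta> (g b y)" UNIV cis] Ck_cis by simp
    with 1 show ?thesis unfolding F_def[abs_def] by (rule Ck_scaleR)
  qed
  have F_eq: "\<forall>\<^sub>F y in nhds 0. \<forall>b\<in>Z. deriv \<psi> (g b y) \<noteq> 0 \<and>
      F b y = (1 / \<bar>deriv \<psi> (g b y)\<bar>) *\<^sub>R cis (\<theta> (g b y))"
  proof (intro eventually_ball_finite[OF fin] ballI)
    fix b assume b: "b \<in> Z"
    have "((\<lambda>y. sgn (deriv \<psi> b) * deriv \<psi> (g b y)) \<longlongrightarrow> sgn (deriv \<psi> b) * deriv \<psi> b) (nhds 0)"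
      by (intro tendsto_mult tendsto_const lim_d b)
    moreover have "sgn (deriv \<psi> b) * deriv \<psi> b > 0" using dZ[OF b] by (simp add: sgn_if)
    ultimately have "\<forall>\<^sub>F y in nhds 0. sgn (deriv \<psi> b) * deriv \<psi> (g b y) > 0"
      by (rule order_tendstoD)
    then show "\<forall>\<^sub>F y in nhds 0. deriv \<psi> (g b y) \<noteq> 0 \<and>
      F b y = (1 / \<bar>deriv \<psi> (g b y)\<bar>) *\<^sub>R cis (\<theta> (g b y))"
      by eventually_elim (auto simp: F_def sgn_if field_simps split: if_splits)
  qed
  have sumZ: "\<forall>\<^sub>F y in nhds 0. y \<noteq> 0 \<longrightarrow> y \<noteq> \<psi> p \<longrightarrow> (\<Sum>b\<in>{b \<in> Z. g b y \<in> {0..p}}. F b y) = 0"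
    using level F_eq
  proof eventually_elim
    case (elim y)
    let ?A = "{b \<in> Z. g b y \<in> {0..p}}"
    have inj: "inj_on (\<lambda>b. g b y) ?A" using elim(1) by (auto intro: inj_on_subset)
    have level_eq: "{t \<in> {0..p}. \<psi> t = y} = (\<lambda>b. g b y) ` ?A" using elim(1) by blast
    have rg: "deriv \<psi> t \<noteq> 0" if "t \<in> {0..p}" "\<psi> t = y" for t
    proof -
      have "t \<in> (\<lambda>b. g b y) ` ?A" using level_eq that by blast
      then show ?thesis using elim(2) by auto
    qed
    have "(\<Sum>b\<in>{t \<in> {0..p}. \<psi> t = y}. (1 / \<bar>deriv \<psi> b\<bar>) *\<^sub>R cis (\<theta> b)) =
        (\<Sum>b\<in>?A. (1 / \<bar>deriv \<psi> (g b y)\<bar>) *\<^sub>R cis (\<theta> (g b y)))"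
      unfolding level_eq by (rule sum.reindex_cong[OF inj]) simp_all
    also have "\<dots> = (\<Sum>b\<in>?A. F b y)" by (rule sum.cong) (use elim(2) in simp_all)
    finally have eq: "(\<Sum>b\<in>{t \<in> {0..p}. \<psi> t = y}. (1 / \<bar>deriv \<psi> b\<bar>) *\<^sub>R cis (\<theta> b)) =
        (\<Sum>b\<in>?A. F b y)" .
    show ?case
    proof (intro impI)
      assume y: "y \<noteq> 0" "y \<noteq> \<psi> p"
      show "(\<Sum>b\<in>?A. F b y) = 0"
        unfolding eq[symmetric] by (rule sum0) (fact rg y)+
    qed
  qed
  \<comment> \<open>The zeros whose branches stay in the interval for small \<open>y > 0\<close>, respectively
    \<open>y < 0\<close>.\<close>
  define Ar where "Ar = {b \<in> Z. b = p \<longrightarrow> deriv \<psi> p < 0}"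
  define Al where "Al = {b \<in> Z. b \<noteq> 0 \<and> (b = p \<longrightarrow> deriv \<psi> p > 0)}"
  have within: "\<forall>\<^sub>F y in nhds 0. g b y < c" if "b \<in> Z" "b < c" for b c
    using order_tendstoD(2)[OF lim[OF that(1)] that(2)] .
  have within': "\<forall>\<^sub>F y in nhds 0. g b y > c" if "b \<in> Z" "b > c" for b c
    using order_tendstoD(1)[OF lim[OF that(1)] that(2)] .
  note at_side = eventually_nhds_imp_at_within
  have inv: "local_inverse \<psi> b (g b)" if "b \<in> Z" for b using g[OF that] by blast
  have side: "(\<forall>\<^sub>F y in at_right 0. g b y \<in> {0..p} \<longleftrightarrow> b \<in> Ar) \<and>
              (\<forall>\<^sub>F y in at_left 0. g b y \<in> {0..p} \<longleftrightarrow> b \<in> Al)" if b: "b \<in> Z" for b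
  proof -
    consider "b = 0" | "b = p" "deriv \<psi> p > 0" | "b = p" "deriv \<psi> p < 0" | "0 < b" "b < p"
      using b dZ[OF b] by (force simp: Z_def)
    then show ?thesis
    proof cases
      case 1
      have m: "b \<in> Ar" "b \<notin> Al" using 1 p b by (auto simp: Ar_def Al_def)
      have d: "deriv \<psi> b > 0" using 1 \<psi>0 by simp
      have lt: "\<forall>\<^sub>F y in nhds 0. g b y < p" using within[OF b, of p] 1 p by simp
      have "\<forall>\<^sub>F y in at_right 0. g b y \<in> {0..p} \<longleftrightarrow> b \<in> Ar"
        using eventually_inverse_side(1)[OF inv[OF b] d] at_side[OF lt, of "{0<..}"]
        by eventually_elim (use 1 m in auto)
      moreover have "\<forall>\<^sub>F y in at_left 0. g b y \<in> {0..p} \<longleftrightarrow> b \<in> Al"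
        using eventually_inverse_side(2)[OF inv[OF b] d] by eventually_elim (use 1 m in auto)
      ultimately show ?thesis ..
    next
      case 2
      have m: "b \<notin> Ar" "b \<in> Al" using 2 p b by (auto simp: Ar_def Al_def)
      have d: "deriv \<psi> b > 0" using 2 by simp
      have gt: "\<forall>\<^sub>F y in nhds 0. g b y > 0" using within'[OF b, of 0] 2 p by simp
      have "\<forall>\<^sub>F y in at_right 0. g b y \<in> {0..p} \<longleftrightarrow> b \<in> Ar"
        using eventually_inverse_side(1)[OF inv[OF b] d] by eventually_elim (use 2 m in auto)
      moreover have "\<forall>\<^sub>F y in at_left 0. g b y \<in> {0..p} \<longleftrightarrow> b \<in> Al"
        using eventually_inverse_side(2)[OF inv[OF b] d] at_side[OF gt, of "{..<0}"]
        by eventually_elim (use 2 m in auto)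
      ultimately show ?thesis ..
    next
      case 3
      have m: "b \<in> Ar" "b \<notin> Al" using 3 p b by (auto simp: Ar_def Al_def)
      have d: "deriv \<psi> b < 0" using 3 by simp
      have gt: "\<forall>\<^sub>F y in nhds 0. g b y > 0" using within'[OF b, of 0] 3 p by simp
      have "\<forall>\<^sub>F y in at_right 0. g b y \<in> {0..p} \<longleftrightarrow> b \<in> Ar"
        using eventually_inverse_side(3)[OF inv[OF b] d] at_side[OF gt, of "{0<..}"]
        by eventually_elim (use 3 m in auto)
      moreover have "\<forall>\<^sub>F y in at_left 0. g b y \<in> {0..p} \<longleftrightarrow> b \<in> Al"
        using eventually_inverse_side(4)[OF inv[OF b] d] by eventually_elim (use 3 m in auto)
      ultimately show ?thesis ..
    next
      case 4
      have m: "b \<in> Ar" "b \<in> Al" using 4 b by (auto simp: Ar_def Al_def)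
      have "\<forall>\<^sub>F y in nhds 0. g b y \<in> {0..p}"
        using within[OF b 4(2)] within'[OF b 4(1)] by eventually_elim auto
      then have "\<forall>\<^sub>F y in at 0 within A. g b y \<in> {0..p}" for A by (rule at_side)
      then show ?thesis using m by simp
    qed
  qed
  define T where "T y = (\<Sum>b\<in>Al. F b y)" for y
  \<comment> \<open>The excluded level \<open>\<psi> p\<close> is either \<open>0\<close> itself or far from \<open>0\<close>.\<close>
  have not_\<psi>p: "\<forall>\<^sub>F y in nhds 0. y \<noteq> 0 \<longrightarrow> y \<noteq> \<psi> p"
  proof (cases "\<psi> p = 0")
    case False
    then have "\<forall>\<^sub>F y in nhds 0. y \<in> - {\<psi> p}" by (intro eventually_nhds_in_open) auto
    then show ?thesis by eventually_elim simp
  qed simp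
  have right: "\<forall>\<^sub>F y in at_right 0. (\<Sum>b\<in>Ar. F b y) = 0"
  proof -
    have "\<forall>\<^sub>F y in at_right 0. \<forall>b\<in>Z. g b y \<in> {0..p} \<longleftrightarrow> b \<in> Ar"
      using side by (intro eventually_ball_finite[OF fin]) blast
    then show ?thesis
      using at_side[OF sumZ, of "{0<..}"] at_side[OF not_\<psi>p, of "{0<..}"] eventually_at_right_less[of 0]
    proof eventually_elim
      case (elim y)
      have "{b \<in> Z. g b y \<in> {0..p}} = Ar" using elim(1) by (auto simp: Ar_def)
      then show ?case using elim by simp
    qed
  qed
  have left: "\<forall>\<^sub>F y in at_left 0. T y = 0"
  proof -
    have "\<forall>\<^sub>F y in at_left 0. \<forall>b\<in>Z. g b y \<in> {0..p} \<longleftrightarrow> b \<in> Al"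
      using side by (intro eventually_ball_finite[OF fin]) blast
    moreover have "\<forall>\<^sub>F y in at_left 0. y < (0::real)" by (simp add: eventually_at_filter)
    ultimately show ?thesis
      using at_side[OF sumZ, of "{..<0}"] at_side[OF not_\<psi>p, of "{..<0}"]
    proof eventually_elim
      case (elim y)
      have "{b \<in> Z. g b y \<in> {0..p}} = Al" using elim(1) by (auto simp: Al_def)
      then show ?case using elim by (simp add: T_def)
    qed
  qed
  have flatT: "flat n T"
  proof -
    define W where "W = (\<Inter>b\<in>Z. V b)"
    have "open W" "0 \<in> W" using g fin by (auto simp: W_def intro!: open_INT)
    moreover have "Ck n W T"
      unfolding T_def[abs_def]
    proof (rule Ck_sum)
      fix b assume "b \<in> Al"
      then have "b \<in> Z" by (simp add: Al_def)
      then show "Ck n W (F b)" using Ck_subset[OF CkF[of b], of W] by (auto simp: W_def)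
    qed
    ultimately show ?thesis using Ck_vanishing_left_flat left by blast
  qed
  have finA: "finite Ar" "finite Al" using fin by (auto simp: Ar_def Al_def)
  have F_sgn: "F b y = sgn (deriv \<psi> b) *\<^sub>R inverse (deriv \<psi> (g b y)) *\<^sub>R cis (\<theta> (g b y))" for b y
    by (simp add: F_def)
  \<comment> \<open>Otherwise the branch at \<open>0\<close> is the only one present on one side and absent on the
    other, and its nonzero limit has nothing to cancel against.\<close>
  have \<psi>p: "\<psi> p = 0"
  proof (rule ccontr)
    assume "\<psi> p \<noteq> 0"
    then have "p \<notin> Z" by (simp add: Z_def)
    then have "Ar = insert 0 Al" "0 \<notin> Al" using Z0 by (auto simp: Ar_def Al_def)
    then have "\<forall>\<^sub>F y in at_right 0. F 0 y = - T y"
      using right finA by (auto simp: T_def add_eq_0_iff2)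
    then have "flat n (F 0)" using flat_cong[OF flat_minus[OF flatT]] by blast
    then have "(F 0 \<longlongrightarrow> 0) (at_right 0)" using flat_mono[of n _ 0] by (simp add: flat_0_iff)
    moreover have "isCont (F 0) 0"
      using Ck_continuous_on[OF CkF[OF Z0]] g[OF Z0] by (simp add: continuous_on_eq_continuous_at)
    then have "(F 0 \<longlongrightarrow> F 0 0) (at_right 0)" by (simp add: isCont_def filterlim_at_split)
    ultimately have "F 0 0 = 0" using tendsto_unique[OF trivial_limit_at_right_real] by blast
    moreover have "deriv \<psi> (g 0 0) \<noteq> 0" using g[OF Z0] by blast
    ultimately show False using \<psi>0 by (simp add: F_def)
  qed
  then have pZ: "p \<in> Z" using p by (simp add: Z_def)
  have "\<forall>\<^sub>F y in at_right 0. inverse (deriv \<psi> (g 0 y)) *\<^sub>R cis (\<theta> (g 0 y)) -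
        inverse (deriv \<psi> (g p y)) *\<^sub>R cis (\<theta> (g p y)) = - T y"
    using right
  proof eventually_elim
    case (elim y)
    define S where "S = (\<Sum>b\<in>Z - {0, p}. F b y)"
    have "F 0 y - sgn (deriv \<psi> p) *\<^sub>R F p y = - T y"
    proof (cases "deriv \<psi> p > 0")
      case True
      then have A: "Ar = insert 0 (Z - {0, p})" "Al = insert p (Z - {0, p})"
        using Z0 pZ p by (auto simp: Ar_def Al_def)
      have "F 0 y + S = 0" using elim fin unfolding A by (simp add: S_def)
      moreover have "T y = F p y + S" using fin unfolding T_def A by (simp add: S_def)
      ultimately show ?thesis using True by (simp add: algebra_simps add_eq_0_iff)
    next
      case False
      then have neg: "deriv \<psi> p < 0" using dZ[OF pZ] by simp
      then have A: "Ar = insert 0 (insert p (Z - {0, p}))" "Al = Z - {0, p}"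
        using Z0 pZ p by (auto simp: Ar_def Al_def)
      have "F 0 y + (F p y + S) = 0" using elim fin p unfolding A by (simp add: S_def)
      moreover have "T y = S" unfolding T_def A S_def ..
      ultimately show ?thesis using neg by (simp add: eq_neg_iff_add_eq_0 add.assoc)
    qed
    moreover have "sgn (deriv \<psi> p) * sgn (deriv \<psi> p) = 1" using dZ[OF pZ] by (simp add: sgn_if)
    ultimately show ?case using \<psi>0(2) by (simp add: F_sgn)
  qed
  then have "flat n (\<lambda>y. inverse (deriv \<psi> (g 0 y)) *\<^sub>R cis (\<theta> (g 0 y)) -
        inverse (deriv \<psi> (g p y)) *\<^sub>R cis (\<theta> (g p y)))"
    by (rule flat_cong[OF flat_minus[OF flatT]])
  then show ?thesis using that[OF \<psi>p inv[OF Z0] inv[OF pZ]] by blast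
qed

text \<open>With \<open>c\<close> the sign of \<open>\<psi>' p\<close>, the substitution \<open>t \<mapsto> p + c t\<close> makes \<open>\<psi>\<close> increasing at \<open>0\<close>
  and moves the branch at \<open>p\<close> to a branch at \<open>0\<close>. It is a translation if \<open>c = 1\<close>
  and a reflection if \<open>c = -1\<close>, whence the factor \<open>c\<^sup>k\<close>.\<close>
lemma endpoint_derivatives_match:
  fixes \<psi> \<theta> :: "real \<Rightarrow> real" and p :: real
  assumes p: "p > 0" and smooth: "Ck (Suc n) UNIV \<psi>" "Ck (Suc n) UNIV \<theta>"
    and \<psi>0: "\<psi> 0 = 0" "deriv \<psi> 0 > 0"
    and reg: "\<And>t. t \<in> {0..p} \<Longrightarrow> \<psi> t = 0 \<Longrightarrow> deriv \<psi> t \<noteq> 0"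
    and sum0: "\<And>y. (\<And>t. t \<in> {0..p} \<Longrightarrow> \<psi> t = y \<Longrightarrow> deriv \<psi> t \<noteq> 0) \<Longrightarrow> y \<noteq> 0 \<Longrightarrow> y \<noteq> \<psi> p \<Longrightarrow>
      (\<Sum>b\<in>{t \<in> {0..p}. \<psi> t = y}. (1 / \<bar>deriv \<psi> b\<bar>) *\<^sub>R cis (\<theta> b)) = 0"
  obtains c :: real where "c = 1 \<or> c = - 1" "\<psi> p = 0" "cis (\<theta> 0 - \<theta> p) = of_real c"
    "\<And>k. k \<le> Suc n \<Longrightarrow> (deriv ^^ k) \<psi> 0 = c ^ k * (deriv ^^ k) \<psi> p"
    "\<And>k. 1 \<le> k \<Longrightarrow> k \<le> n \<Longrightarrow> (deriv ^^ k) \<theta> 0 = c ^ k * (deriv ^^ k) \<theta> p"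
proof -
  obtain G g where \<psi>p: "\<psi> p = 0" and inv: "local_inverse \<psi> 0 G" "local_inverse \<psi> p g"
    and flat: "flat n (\<lambda>y. inverse (deriv \<psi> (G y)) *\<^sub>R cis (\<theta> (G y)) -
        inverse (deriv \<psi> (g y)) *\<^sub>R cis (\<theta> (g y)))"
    by (rule endpoint_branches_cancel[OF assms]) (assumption | rule that)+
  define c where "c = sgn (deriv \<psi> p)"
  have dp: "deriv \<psi> p \<noteq> 0" using reg[of p] p \<psi>p by simp
  then have c: "c = 1 \<or> c = - 1" by (auto simp: c_def sgn_if)
  then have cc: "c * c = 1" by auto
  have cc': "c * (c * x) = x" for x using cc by (simp add: mult.assoc[symmetric])
  define \<xi> where "\<xi> t = \<psi> (p + c * t)" for t
  define \<eta> where "\<eta> t = \<theta> (p + c * t)" for t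
  have d\<xi>: "deriv \<xi> t = c * deriv \<psi> (p + c * t)" for t
    unfolding \<xi>_def[abs_def] by (rule deriv_affine[OF smooth(1)])
  have smooth': "Ck (Suc n) UNIV \<xi>" "Ck (Suc n) UNIV \<eta>"
    unfolding \<xi>_def[abs_def] \<eta>_def[abs_def]
    using Ck_compose[OF Ck_affine[of _ UNIV p c] _ smooth(1)]
      Ck_compose[OF Ck_affine[of _ UNIV p c] _ smooth(2)] by (simp_all del: Ck.simps)
  define H where "H y = c * (g y - p)" for y
  have Hg: "p + c * H y = g y" for y by (simp add: H_def cc')
  have invH: "local_inverse \<xi> 0 H"
    unfolding \<xi>_def[abs_def] H_def[abs_def] by (rule local_inverse_reflect[OF smooth(1) inv(2) cc])
  have "inverse c = c" using cc by (metis inverse_unique)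
  then have flat': "flat n (\<lambda>y. inverse (deriv \<psi> (G y)) *\<^sub>R cis (\<theta> (G y)) +
      (- c * inverse (deriv \<xi> (H y))) *\<^sub>R cis (\<eta> (H y)))"
    using flat by (simp add: d\<xi> \<eta>_def Hg cc')
  have pos: "deriv \<xi> 0 > 0" using dp by (simp add: d\<xi> c_def sgn_if)
  have c1: "\<bar>- c\<bar> = 1" using c by auto
  have \<xi>0: "\<xi> 0 = 0" by (simp add: \<xi>_def \<psi>p)
  note agree = branches_agree[OF c1 smooth(1) smooth'(1) smooth(2) smooth'(2) \<psi>0(1) \<xi>0 \<psi>0(2) pos
      inv(1) invH flat']
  show ?thesis
  proof (rule that[OF c \<psi>p])
    show "cis (\<theta> 0 - \<theta> p) = of_real c" using agree(2) by (simp add: \<eta>_def)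
  next
    fix k assume k: "k \<le> Suc n"
    have "Ck (Suc n) UNIV (\<lambda>t. 1 * \<psi> t + (- 1) * \<xi> t)"
      by (intro Ck_add Ck_mult Ck_const smooth smooth')
    moreover have "flat (Suc n) (\<lambda>t. 1 * \<psi> t + (- 1) * \<xi> t)" using agree(1) by simp
    ultimately have "(deriv ^^ k) (\<lambda>t. 1 * \<psi> t + (- 1) * \<xi> t) 0 = 0"
      using k by (rule flat_imp_derivs_eq_0)
    then have "(deriv ^^ k) \<psi> 0 = (deriv ^^ k) \<xi> 0"
      unfolding funpow_deriv_lincomb[OF smooth(1) smooth'(1) k] by simp
    then show "(deriv ^^ k) \<psi> 0 = c ^ k * (deriv ^^ k) \<psi> p"
      unfolding \<xi>_def[abs_def] funpow_deriv_affine[OF smooth(1) k] by simp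
  next
    fix k :: nat assume k: "1 \<le> k" "k \<le> n"
    define w where "w = \<theta> 0 - \<eta> 0"
    have S: "Ck n UNIV \<theta>" "Ck n UNIV \<eta>" using smooth smooth' Ck_Suc_imp_Ck by blast+
    have S2: "Ck n UNIV (\<lambda>t. 1 * \<theta> t + (- 1) * \<eta> t)" by (intro Ck_add Ck_mult Ck_const S)
    have "Ck n UNIV (\<lambda>t. 1 * (1 * \<theta> t + (- 1) * \<eta> t) + 1 * (- w))"
      by (intro Ck_add Ck_mult Ck_const S)
    moreover have "flat n (\<lambda>t. 1 * (1 * \<theta> t + (- 1) * \<eta> t) + 1 * (- w))"
      using agree(3) by (simp add: w_def algebra_simps)
    ultimately have "(deriv ^^ k) (\<lambda>t. 1 * (1 * \<theta> t + (- 1) * \<eta> t) + 1 * (- w)) 0 = 0"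
      using k(2) by (rule flat_imp_derivs_eq_0)
    then have "(deriv ^^ k) \<theta> 0 = (deriv ^^ k) \<eta> 0"
      unfolding funpow_deriv_lincomb[OF S2 Ck_const k(2)] funpow_deriv_lincomb[OF S k(2)]
      using k by (simp add: funpow_deriv_const)
    then show "(deriv ^^ k) \<theta> 0 = c ^ k * (deriv ^^ k) \<theta> p"
      unfolding \<eta>_def[abs_def] funpow_deriv_affine[OF S(1) k(2)] by simp
  qed
qed

theorem proposition3p1:
  fixes h :: nat and \<theta> \<phi> :: "real \<Rightarrow> real"
  assumes "h \<ge> 1"
    and "C_on_I h \<theta>" and "C_on_I h \<phi>"
    and "\<And>a. regular_value \<phi> a \<Longrightarrow> a \<noteq> \<phi> 0 \<Longrightarrow> a \<noteq> \<phi> (2 * pi) \<Longrightarrow>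
           (\<Sum>b\<in>{b \<in> I. \<phi> b = a}. exp (\<i> * complex_of_real (\<theta> b)) / complex_of_real \<bar>nderiv 1 \<phi> b\<bar>) = 0"
    and "\<not> critical_value \<phi> (\<phi> 0)"
  shows "\<phi> 0 = \<phi> (2 * pi) \<and>
    (([\<theta> (2 * pi) - \<theta> 0 = 0] (rmod 2 * pi) \<and>
      (\<forall>k\<in>{1..h - 1}. nderiv k \<theta> 0 = nderiv k \<theta> (2 * pi)) \<and>
      (\<forall>k\<in>{1..h}. nderiv k \<phi> 0 = nderiv k \<phi> (2 * pi)))
     \<or>
     ([\<theta> (2 * pi) - \<theta> 0 = pi] (rmod 2 * pi) \<and>
      (\<forall>k\<in>{1..h - 1}. nderiv k \<theta> 0 = (-1) ^ k * nderiv k \<theta> (2 * pi)) \<and>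
      (\<forall>k\<in>{1..h}. nderiv k \<phi> 0 = (-1) ^ k * nderiv k \<phi> (2 * pi))))"
proof -
  obtain n where h: "h = Suc n" using assms(1) by (cases h) auto
  obtain \<Theta> where \<Theta>: "Ck (Suc n) UNIV \<Theta>"
    "\<And>k t. k \<le> Suc n \<Longrightarrow> t \<in> I \<Longrightarrow> (deriv ^^ k) \<Theta> t = nderiv k \<theta> t"
    using C_on_I_extend[OF assms(2)] h by auto
  obtain \<Phi> where \<Phi>: "Ck (Suc n) UNIV \<Phi>"
    "\<And>k t. k \<le> Suc n \<Longrightarrow> t \<in> I \<Longrightarrow> (deriv ^^ k) \<Phi> t = nderiv k \<phi> t"
    using C_on_I_extend[OF assms(3)] h by auto
  have ends: "0 \<in> I" "2 * pi \<in> I" by (auto simp: I_def)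
  have eq: "\<Theta> t = \<theta> t" "\<Phi> t = \<phi> t" "deriv \<Phi> t = nderiv 1 \<phi> t" if "t \<in> I" for t
    using \<Theta>(2)[of 0 t] \<Phi>(2)[of 0 t] \<Phi>(2)[of 1 t] that by (simp_all del: nderiv.simps(2))
  \<comment> \<open>Normalise to level \<open>0\<close> and a positive derivative at the left endpoint; the sum in the
    hypothesis depends on \<open>\<phi>'\<close> only through its modulus.\<close>
  define s where "s = sgn (deriv \<Phi> 0)"
  define \<psi> where "\<psi> t = s * \<Phi> t + (- s * \<phi> 0) * 1" for t
  have \<psi>: "Ck (Suc n) UNIV \<psi>"
    unfolding \<psi>_def[abs_def] by (intro Ck_add Ck_mult Ck_const \<Phi>)
  have d\<psi>: "(deriv ^^ k) \<psi> t = s * (deriv ^^ k) \<Phi> t" if "1 \<le> k" "k \<le> Suc n" for k t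
    using fun_cong[OF funpow_deriv_lincomb[OF \<Phi>(1) Ck_const that(2)], of s "- s * \<phi> 0" 1 t] that
    by (simp add: \<psi>_def[abs_def] funpow_deriv_const)
  have d1: "deriv \<psi> t = s * deriv \<Phi> t" for t using d\<psi>[of 1 t] by simp
  have d0: "deriv \<Phi> 0 \<noteq> 0"
    using assms(5) ends eq by (auto simp: critical_value_def simp del: nderiv.simps(2))
  then have s: "s * s = 1" "\<bar>s\<bar> = 1" "s \<noteq> 0" by (auto simp: s_def sgn_if)
  have \<psi>_eq: "\<psi> t = y \<longleftrightarrow> \<phi> t = \<phi> 0 + s * y" if "t \<in> I" for t y
  proof -
    have "\<psi> t = s * (\<phi> t - \<phi> 0)" using that by (simp add: \<psi>_def eq algebra_simps)
    moreover have "s * (\<phi> t - \<phi> 0) = y \<longleftrightarrow> s * (s * (\<phi> t - \<phi> 0)) = s * y" using s by simp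
    moreover have "s * (s * (\<phi> t - \<phi> 0)) = \<phi> t - \<phi> 0" using s by (simp add: mult.assoc[symmetric])
    ultimately have "\<psi> t = y \<longleftrightarrow> \<phi> t - \<phi> 0 = s * y" by metis
    then show ?thesis by linarith
  qed
  have pi: "2 * pi > 0" by simp
  have \<psi>0: "\<psi> 0 = 0" using \<psi>_eq[OF ends(1), of 0] by simp
  have d\<psi>0: "deriv \<psi> 0 > 0" using d0 by (simp add: d1 s_def sgn_if)
  have reg: "deriv \<psi> t \<noteq> 0" if "t \<in> {0..2 * pi}" "\<psi> t = 0" for t
    using that assms(5) \<psi>_eq[of t 0] eq(3)[of t] s
    by (auto simp: critical_value_def I_def d1 simp del: nderiv.simps(2))
  have sum0: "(\<Sum>b\<in>{t \<in> {0..2 * pi}. \<psi> t = y}. (1 / \<bar>deriv \<psi> b\<bar>) *\<^sub>R cis (\<Theta> b)) = 0"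
    if r: "\<And>t. t \<in> {0..2 * pi} \<Longrightarrow> \<psi> t = y \<Longrightarrow> deriv \<psi> t \<noteq> 0" and y: "y \<noteq> 0" "y \<noteq> \<psi> (2 * pi)" for y
  proof -
    define a where "a = \<phi> 0 + s * y"
    have "regular_value \<phi> a"
      unfolding regular_value_def critical_value_def
    proof
      assume "\<exists>t\<in>I. \<phi> t = a \<and> nderiv 1 \<phi> t = 0"
      then obtain t where t: "t \<in> I" "\<phi> t = a" "nderiv 1 \<phi> t = 0" by blast
      then have "\<psi> t = y" using \<psi>_eq by (simp add: a_def)
      then show False using r[of t] t eq(3)[of t] by (simp add: d1 I_def del: nderiv.simps(2))
    qed
    moreover have "a \<noteq> \<phi> 0" using y s by (simp add: a_def)
    moreover have "a \<noteq> \<phi> (2 * pi)" using y(2) \<psi>_eq[OF ends(2), of y] by (auto simp: a_def)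
    ultimately have "(\<Sum>b\<in>{b \<in> I. \<phi> b = a}. exp (\<i> * complex_of_real (\<theta> b)) / complex_of_real \<bar>nderiv 1 \<phi> b\<bar>) = 0"
      by (rule assms(4))
    moreover have "(\<Sum>b\<in>{t \<in> {0..2 * pi}. \<psi> t = y}. (1 / \<bar>deriv \<psi> b\<bar>) *\<^sub>R cis (\<Theta> b)) =
      (\<Sum>b\<in>{b \<in> I. \<phi> b = a}. exp (\<i> * complex_of_real (\<theta> b)) / complex_of_real \<bar>nderiv 1 \<phi> b\<bar>)"
    proof (rule sum.cong)
      show "{t \<in> {0..2 * pi}. \<psi> t = y} = {b \<in> I. \<phi> b = a}"
        using \<psi>_eq by (auto simp: a_def I_def)
      fix b assume "b \<in> {b \<in> I. \<phi> b = a}"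
      then show "(1 / \<bar>deriv \<psi> b\<bar>) *\<^sub>R cis (\<Theta> b) =
          exp (\<i> * complex_of_real (\<theta> b)) / complex_of_real \<bar>nderiv 1 \<phi> b\<bar>"
        using s by (simp add: d1 eq abs_mult cis_conv_exp scaleR_conv_of_real field_simps
            del: nderiv.simps(2))
    qed
    ultimately show ?thesis by simp
  qed
  obtain c :: real where c: "c = 1 \<or> c = - 1" and \<psi>p: "\<psi> (2 * pi) = 0"
    and cis: "cis (\<Theta> 0 - \<Theta> (2 * pi)) = of_real c"
    and D\<psi>: "\<And>k. k \<le> Suc n \<Longrightarrow> (deriv ^^ k) \<psi> 0 = c ^ k * (deriv ^^ k) \<psi> (2 * pi)"
    and D\<Theta>: "\<And>k. 1 \<le> k \<Longrightarrow> k \<le> n \<Longrightarrow> (deriv ^^ k) \<Theta> 0 = c ^ k * (deriv ^^ k) \<Theta> (2 * pi)"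
    by (rule endpoint_derivatives_match[OF pi \<psi> \<Theta>(1) \<psi>0 d\<psi>0 reg sum0]) (assumption | rule that)+
  have \<phi>: "nderiv k \<phi> 0 = c ^ k * nderiv k \<phi> (2 * pi)" if "1 \<le> k" "k \<le> h" for k
    using D\<psi>[of k] d\<psi>[of k] \<Phi>(2)[of k] that ends s by (simp add: h mult.left_commute)
  have \<theta>: "nderiv k \<theta> 0 = c ^ k * nderiv k \<theta> (2 * pi)" if "1 \<le> k" "k \<le> h - 1" for k
    using D\<Theta>[of k] \<Theta>(2)[of k] that ends by (simp add: h)
  have \<phi>p: "\<phi> 0 = \<phi> (2 * pi)" using \<psi>p \<psi>_eq[OF ends(2), of 0] by simp
  have "cis (\<theta> (2 * pi) - \<theta> 0) = cnj (cis (\<Theta> 0 - \<Theta> (2 * pi)))" using ends eq by (simp add: cis_cnj)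
  then have cis': "cis (\<theta> (2 * pi) - \<theta> 0) = of_real c" using cis by simp
  from c show ?thesis
  proof
    assume c: "c = 1"
    then have "cis (\<theta> (2 * pi) - \<theta> 0) = cis 0" using cis' by simp
    then have "[\<theta> (2 * pi) - \<theta> 0 = 0] (rmod 2 * pi)" by (simp only: cis_eq_iff)
    then show ?thesis using \<phi> \<theta> \<phi>p c by simp
  next
    assume c: "c = - 1"
    then have "cis (\<theta> (2 * pi) - \<theta> 0) = cis pi" using cis' by simp
    then have "[\<theta> (2 * pi) - \<theta> 0 = pi] (rmod 2 * pi)" by (simp only: cis_eq_iff)
    then show ?thesis using \<phi> \<theta> \<phi>p c by simp
  qed
qed

end
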